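(* Let $(\mathcal{M}, g, A)$ be a K\"ahler manifold of dimension $n$ with a quarter-symmetric metric $A$-connection $\overset{1}{\nabla}_XY=\overset{g}{\nabla}_XY-\pi(X)AY$ with generator $\pi$. If the tensor $\overset{0}{H}$ (defined in the context) vanishes, then $$\overset{g}{P}(X,Y)Z=\frac{n-2}{n+2}\,\overset{g}{W}(X,Y)Z$$ for all vector fields $X,Y,Z$, where $\overset{g}{P}$ is the holomorphically projective curvature tensor and $\overset{g}{W}$ is the Weyl projective curvature tensor.
   Context: A K\"ahler manifold $(\mathcal{M},g,A)$ is a Riemannian manifold $(\mathcal{M},g)$ of dimension $n=2k\ge4$ with a $(1,1)$ tensor field $A$ satisfying $A^2=-I$, $g(AX,AY)=g(X,Y)$ and $\overset{g}{\nabla}A=0$, where $\overset{g}{\nabla}$ is the Levi-Civita connection. $\overset{g}{R}$ is the Riemannian curvature tensor of $g$, $\overset{g}{R}(X,Y)Z=\overset{g}{\nabla}_X\overset{g}{\nabla}_YZ-\overset{g}{\nabla}_Y\overset{g}{\nabla}_XZ-\overset{g}{\nabla}_{[X,Y]}Z$, and $\overset{g}{R}ic(Y,Z)=\mathrm{Trace}\{X\mapsto\overset{g}{R}(X,Y)Z\}$. Define $$\overset{g}{W}(X,Y)Z=\overset{g}{R}(X,Y)Z+\tfrac{1}{n-1}\big(\overset{g}{R}ic(X,Z)Y-\overset{g}{R}ic(Y,Z)X\big),$$ $$\overset{g}{P}(X,Y)Z=\overset{g}{R}(X,Y)Z+\tfrac{1}{n+2}\big(\overset{g}{R}ic(X,Z)Y-\overset{g}{R}ic(Y,Z)X\big)-\tfrac{1}{n+2}\big(\overset{g}{R}ic(X,AZ)AY-\overset{g}{R}ic(Y,AZ)AX+2\overset{g}{R}ic(X,AY)AZ\big).$$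 For a 1-form $\pi$ put $$\overset{0}{D}(X,Y)=(\overset{g}{\nabla}_X\pi)(Y)+\tfrac12\pi(X)\pi(AY)+\tfrac12\pi(Y)\pi(AX),\quad \overset{1}{D}(X,Y)=(\overset{g}{\nabla}_X\pi)(Y)-(\overset{g}{\nabla}_Y\pi)(X),$$ $$\overset{2}{D}(X,Y)=(\overset{g}{\nabla}_X\pi)(Y)+\pi(Y)\pi(AX),\quad \overset{3}{D}(X,Y)=(\overset{g}{\nabla}_X\pi)(Y)+\pi(X)\pi(AY),$$ and define $$\overset{0}{R}(X,Y)Z=\overset{g}{R}(X,Y)Z-\tfrac12\big(\overset{0}{D}(X,Y)-\overset{0}{D}(Y,X)\big)AZ-\tfrac12\overset{0}{D}(X,Z)AY+\tfrac12\overset{0}{D}(Y,Z)AX+\tfrac14\pi(Z)\big(\pi(Y)X-\pi(X)Y\big),$$ $$\overset{1}{R}(X,Y)Z=\overset{g}{R}(X,Y)Z-\overset{1}{D}(X,Y)AZ,$$ $$\overset{3}{R}(X,Y)Z=\overset{g}{R}(X,Y)Z-\overset{2}{D}(X,Y)AZ+\overset{3}{D}(Y,Z)AX,$$ with $\overset{\theta}{R}ic(Y,Z)=\mathrm{Trace}\{X\mapsto\overset{\theta}{R}(X,Y)Z\}$ for $\theta\in\{0,1,3\}$ and $\overset{3}{'R}(X,Y)=\mathrm{Trace}\{Z\mapsto\overset{3}{R}(X,Y)Z\}$. Finally $$\begin{aligned}\overset{0}{H}(X,Y)Z={}&\overset{0}{R}(X,Y)Z+\tfrac{1}{n-1}\big(\overset{0}{R}ic(X,Z)Y-\overset{0}{R}ic(Y,Z)X\big)-\tfrac{1}{2(n-1)}\big(\overset{1}{R}ic(X,Z)Y-\overset{1}{R}ic(Y,Z)X\big)\\&-\tfrac{1}{4(n-1)}\big(\overset{3}{R}ic(Z,X)Y-\overset{3}{R}ic(Z,Y)X+\overset{3}{'R}(AZ,AX)Y-\overset{3}{'R}(AZ,AY)X\big)\\&+\tfrac14\big(2\overset{1}{R}ic(Y,AX)AZ+\overset{3}{R}ic(Z,AX)AY-\overset{3}{R}ic(Z,AY)AX\big)-\tfrac14\big(\overset{3}{'R}(AZ,X)AY-\overset{3}{'R}(AZ,Y)AX\big).\end{aligned}$$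 *)

theory Defs
  imports "HOL-Analysis.Analysis"
begin

section \<open>Smooth maps between Euclidean spaces\<close>

text \<open>
  Only used for open \<open>S\<close>. In finite dimension, continuity of all iterated directional
  derivatives is the usual notion of class \<open>C\<^sup>k\<close>.
\<close>

primrec Ck_on :: "nat \<Rightarrow> 'a::real_normed_vector set \<Rightarrow> ('a \<Rightarrow> 'b::real_normed_vector) \<Rightarrow> bool" where
  "Ck_on 0 S f \<longleftrightarrow> continuous_on S f"
| "Ck_on (Suc k) S f \<longleftrightarrow>
     (\<forall>x\<in>S. f differentiable (at x)) \<and> (\<forall>v. Ck_on k S (\<lambda>x. frechet_derivative f (at x) v))"

definition smooth_on :: "'a::real_normed_vector set \<Rightarrow> ('a \<Rightarrow> 'b::real_normed_vector) \<Rightarrow> bool" where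
  "smooth_on S f \<longleftrightarrow> (\<forall>k. Ck_on k S f)"


section \<open>Smooth manifolds\<close>

text \<open>A chart is a pair of a coordinate domain and a coordinate map.\<close>

type_synonym ('m, 'n) chart = "'m set \<times> ('m \<Rightarrow> real^'n)"

definition chart_image :: "('m, 'n) chart \<Rightarrow> (real^'n) set" where
  "chart_image c = snd c ` fst c"

definition overlap :: "('m, 'n) chart \<Rightarrow> ('m, 'n) chart \<Rightarrow> (real^'n) set" where
  "overlap c d = snd c ` (fst c \<inter> fst d)"

definition transition :: "('m, 'n) chart \<Rightarrow> ('m, 'n) chart \<Rightarrow> real^'n \<Rightarrow> real^'n" where
  "transition c d = (\<lambda>x. snd d (inv_into (fst c) (snd c) x))"

abbreviation dtransition ::
  "('m, 'n::finite) chart \<Rightarrow> ('m, 'n) chart \<Rightarrow> real^'n \<Rightarrow> real^'n \<Rightarrow> real^'n" where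
  "dtransition c d x \<equiv> frechet_derivative (transition c d) (at x)"

text \<open>The dimension of the manifold is \<open>CARD('n)\<close>. The atlas need not be maximal.\<close>

definition smooth_manifold :: "'m topology \<Rightarrow> ('m, 'n::finite) chart set \<Rightarrow> bool" where
  "smooth_manifold M \<A> \<longleftrightarrow>
     Hausdorff_space M \<and> second_countable M \<and>
     (\<Union>c\<in>\<A>. fst c) = topspace M \<and>
     (\<forall>c\<in>\<A>. openin M (fst c) \<and> open (chart_image c) \<and>
        homeomorphic_map (subtopology M (fst c)) (top_of_set (chart_image c)) (snd c)) \<and>
     (\<forall>c\<in>\<A>. \<forall>d\<in>\<A>. smooth_on (overlap c d) (transition c d))"


section \<open>Tensor fields\<close>

text \<open>
  A tensor field is given by its local representatives: one for each chart of the atlas, defined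
  on the image of the chart, such that the representatives are related by the differential of the
  transition map wherever two charts overlap. Values outside of the chart image are irrelevant.
\<close>

definition vector_field ::
  "('m, 'n::finite) chart set \<Rightarrow> (('m, 'n) chart \<Rightarrow> real^'n \<Rightarrow> real^'n) \<Rightarrow> bool" where
  "vector_field \<A> X \<longleftrightarrow>
     (\<forall>c\<in>\<A>. smooth_on (chart_image c) (X c)) \<and>
     (\<forall>c\<in>\<A>. \<forall>d\<in>\<A>. \<forall>x\<in>overlap c d.
        X d (transition c d x) = dtransition c d x (X c x))"

definition one_form ::
  "('m, 'n::finite) chart set \<Rightarrow> (('m, 'n) chart \<Rightarrow> real^'n \<Rightarrow> real^'n \<Rightarrow> real) \<Rightarrow> bool" where
  "one_form \<A> \<pi> \<longleftrightarrow>
     (\<forall>c\<in>\<A>. (\<forall>x\<in>chart_image c. linear (\<pi> c x)) \<and>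
        (\<forall>u. smooth_on (chart_image c) (\<lambda>x. \<pi> c x u))) \<and>
     (\<forall>c\<in>\<A>. \<forall>d\<in>\<A>. \<forall>x\<in>overlap c d. \<forall>u.
        \<pi> d (transition c d x) (dtransition c d x u) = \<pi> c x u)"

definition tensor_field_1_1 ::
  "('m, 'n::finite) chart set \<Rightarrow> (('m, 'n) chart \<Rightarrow> real^'n \<Rightarrow> real^'n \<Rightarrow> real^'n) \<Rightarrow> bool" where
  "tensor_field_1_1 \<A> A \<longleftrightarrow>
     (\<forall>c\<in>\<A>. (\<forall>x\<in>chart_image c. linear (A c x)) \<and>
        (\<forall>u. smooth_on (chart_image c) (\<lambda>x. A c x u))) \<and>
     (\<forall>c\<in>\<A>. \<forall>d\<in>\<A>. \<forall>x\<in>overlap c d. \<forall>u.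
        A d (transition c d x) (dtransition c d x u) = dtransition c d x (A c x u))"

definition riemannian_metric ::
  "('m, 'n::finite) chart set \<Rightarrow> (('m, 'n) chart \<Rightarrow> real^'n \<Rightarrow> real^'n \<Rightarrow> real^'n \<Rightarrow> real) \<Rightarrow> bool" where
  "riemannian_metric \<A> g \<longleftrightarrow>
     (\<forall>c\<in>\<A>.
        (\<forall>x\<in>chart_image c. bilinear (g c x) \<and> (\<forall>u v. g c x u v = g c x v u) \<and>
           (\<forall>u. u \<noteq> 0 \<longrightarrow> 0 < g c x u u)) \<and>
        (\<forall>u v. smooth_on (chart_image c) (\<lambda>x. g c x u v))) \<and>
     (\<forall>c\<in>\<A>. \<forall>d\<in>\<A>. \<forall>x\<in>overlap c d. \<forall>u v.
        g d (transition c d x) (dtransition c d x u) (dtransition c d x v) = g c x u v)"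


section \<open>Connections\<close>

subsection \<open>Local operators in a coordinate domain\<close>

text \<open>
  Here \<open>X\<close>, \<open>Y\<close>, \<open>Z\<close>, \<open>\<Gamma>\<close>, \<open>A\<close>, \<open>\<pi>\<close> are local representatives in one fixed chart. The connection
  with coefficients \<open>\<Gamma>\<close> is \<open>\<nabla>\<^sub>X Y = X(Y) + \<Gamma>(X, Y)\<close>.
\<close>

definition lie_bracket ::
  "(real^'n::finite \<Rightarrow> real^'n) \<Rightarrow> (real^'n \<Rightarrow> real^'n) \<Rightarrow> real^'n \<Rightarrow> real^'n" where
  "lie_bracket X Y = (\<lambda>x. frechet_derivative Y (at x) (X x) - frechet_derivative X (at x) (Y x))"

definition nabla ::
  "(real^'n::finite \<Rightarrow> real^'n \<Rightarrow> real^'n \<Rightarrow> real^'n) \<Rightarrow>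
   (real^'n \<Rightarrow> real^'n) \<Rightarrow> (real^'n \<Rightarrow> real^'n) \<Rightarrow> real^'n \<Rightarrow> real^'n" where
  "nabla \<Gamma> X Y = (\<lambda>x. frechet_derivative Y (at x) (X x) + \<Gamma> x (X x) (Y x))"

text \<open>\<open>(\<nabla>\<^sub>X \<pi>)(Y) = X(\<pi>(Y)) - \<pi>(\<nabla>\<^sub>X Y)\<close> and \<open>(\<nabla>\<^sub>X A)Y = \<nabla>\<^sub>X (AY) - A(\<nabla>\<^sub>X Y)\<close>.\<close>

definition nabla_form ::
  "(real^'n::finite \<Rightarrow> real^'n \<Rightarrow> real^'n \<Rightarrow> real^'n) \<Rightarrow> (real^'n \<Rightarrow> real^'n \<Rightarrow> real) \<Rightarrow>
   (real^'n \<Rightarrow> real^'n) \<Rightarrow> (real^'n \<Rightarrow> real^'n) \<Rightarrow> real^'n \<Rightarrow> real" where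
  "nabla_form \<Gamma> \<pi> X Y =
     (\<lambda>x. frechet_derivative (\<lambda>y. \<pi> y (Y y)) (at x) (X x) - \<pi> x (nabla \<Gamma> X Y x))"

definition nabla_endo ::
  "(real^'n::finite \<Rightarrow> real^'n \<Rightarrow> real^'n \<Rightarrow> real^'n) \<Rightarrow> (real^'n \<Rightarrow> real^'n \<Rightarrow> real^'n) \<Rightarrow>
   (real^'n \<Rightarrow> real^'n) \<Rightarrow> (real^'n \<Rightarrow> real^'n) \<Rightarrow> real^'n \<Rightarrow> real^'n" where
  "nabla_endo \<Gamma> A X Y = (\<lambda>x. nabla \<Gamma> X (\<lambda>y. A y (Y y)) x - A x (nabla \<Gamma> X Y x))"

definition curvature ::
  "(real^'n::finite \<Rightarrow> real^'n \<Rightarrow> real^'n \<Rightarrow> real^'n) \<Rightarrow>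
   (real^'n \<Rightarrow> real^'n) \<Rightarrow> (real^'n \<Rightarrow> real^'n) \<Rightarrow> (real^'n \<Rightarrow> real^'n) \<Rightarrow> real^'n \<Rightarrow> real^'n" where
  "curvature \<Gamma> X Y Z =
     (\<lambda>x. nabla \<Gamma> X (nabla \<Gamma> Y Z) x - nabla \<Gamma> Y (nabla \<Gamma> X Z) x - nabla \<Gamma> (lie_bracket X Y) Z x)"


subsection \<open>Affine connections and the Levi-Civita connection\<close>

text \<open>
  The last condition is the classical transformation law of connection coefficients, that is, the
  covariant derivative of vector fields does not depend on the chart.
\<close>

definition affine_connection ::
  "('m, 'n::finite) chart set \<Rightarrow>
   (('m, 'n) chart \<Rightarrow> real^'n \<Rightarrow> real^'n \<Rightarrow> real^'n \<Rightarrow> real^'n) \<Rightarrow> bool" where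
  "affine_connection \<A> \<Gamma> \<longleftrightarrow>
     (\<forall>c\<in>\<A>. (\<forall>x\<in>chart_image c. bilinear (\<Gamma> c x)) \<and>
        (\<forall>u v. smooth_on (chart_image c) (\<lambda>x. \<Gamma> c x u v))) \<and>
     (\<forall>c\<in>\<A>. \<forall>d\<in>\<A>. \<forall>x\<in>overlap c d. \<forall>u v.
        \<Gamma> d (transition c d x) (dtransition c d x u) (dtransition c d x v) =
        dtransition c d x (\<Gamma> c x u v) - frechet_derivative (\<lambda>y. dtransition c d y v) (at x) u)"

definition torsion_free ::
  "('m, 'n::finite) chart set \<Rightarrow>
   (('m, 'n) chart \<Rightarrow> real^'n \<Rightarrow> real^'n \<Rightarrow> real^'n \<Rightarrow> real^'n) \<Rightarrow> bool" where
  "torsion_free \<A> \<Gamma> \<longleftrightarrow>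
     (\<forall>c\<in>\<A>. \<forall>X Y. smooth_on (chart_image c) X \<longrightarrow> smooth_on (chart_image c) Y \<longrightarrow>
        (\<forall>x\<in>chart_image c. nabla (\<Gamma> c) X Y x - nabla (\<Gamma> c) Y X x = lie_bracket X Y x))"

definition metric_connection ::
  "('m, 'n::finite) chart set \<Rightarrow> (('m, 'n) chart \<Rightarrow> real^'n \<Rightarrow> real^'n \<Rightarrow> real^'n \<Rightarrow> real) \<Rightarrow>
   (('m, 'n) chart \<Rightarrow> real^'n \<Rightarrow> real^'n \<Rightarrow> real^'n \<Rightarrow> real^'n) \<Rightarrow> bool" where
  "metric_connection \<A> g \<Gamma> \<longleftrightarrow>
     (\<forall>c\<in>\<A>. \<forall>X Y Z. smooth_on (chart_image c) X \<longrightarrow> smooth_on (chart_image c) Y \<longrightarrow>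
          smooth_on (chart_image c) Z \<longrightarrow>
        (\<forall>x\<in>chart_image c. frechet_derivative (\<lambda>y. g c y (Y y) (Z y)) (at x) (X x) =
           g c x (nabla (\<Gamma> c) X Y x) (Z x) + g c x (Y x) (nabla (\<Gamma> c) X Z x)))"

definition levi_civita ::
  "('m, 'n::finite) chart set \<Rightarrow> (('m, 'n) chart \<Rightarrow> real^'n \<Rightarrow> real^'n \<Rightarrow> real^'n \<Rightarrow> real) \<Rightarrow>
   (('m, 'n) chart \<Rightarrow> real^'n \<Rightarrow> real^'n \<Rightarrow> real^'n \<Rightarrow> real^'n) \<Rightarrow> bool" where
  "levi_civita \<A> g \<Gamma> \<longleftrightarrow>
     affine_connection \<A> \<Gamma> \<and> torsion_free \<A> \<Gamma> \<and> metric_connection \<A> g \<Gamma>"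


subsection \<open>Kaehler manifolds and quarter-symmetric metric A-connections\<close>

text \<open>\<open>\<Gamma>\<close> is (the family of coefficients of) the Levi-Civita connection of \<open>g\<close>.\<close>

definition kaehler_manifold ::
  "'m topology \<Rightarrow> ('m, 'n::finite) chart set \<Rightarrow>
   (('m, 'n) chart \<Rightarrow> real^'n \<Rightarrow> real^'n \<Rightarrow> real^'n \<Rightarrow> real) \<Rightarrow>
   (('m, 'n) chart \<Rightarrow> real^'n \<Rightarrow> real^'n \<Rightarrow> real^'n) \<Rightarrow>
   (('m, 'n) chart \<Rightarrow> real^'n \<Rightarrow> real^'n \<Rightarrow> real^'n \<Rightarrow> real^'n) \<Rightarrow> bool" where
  "kaehler_manifold M \<A> g A \<Gamma> \<longleftrightarrow>
     smooth_manifold M \<A> \<and> even CARD('n) \<and> 4 \<le> CARD('n) \<and>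
     riemannian_metric \<A> g \<and> tensor_field_1_1 \<A> A \<and> levi_civita \<A> g \<Gamma> \<and>
     (\<forall>c\<in>\<A>. \<forall>x\<in>chart_image c. \<forall>u v.
        A c x (A c x u) = - u \<and> g c x (A c x u) (A c x v) = g c x u v) \<and>
     (\<forall>c\<in>\<A>. \<forall>X Y. smooth_on (chart_image c) X \<longrightarrow> smooth_on (chart_image c) Y \<longrightarrow>
        (\<forall>x\<in>chart_image c. nabla_endo (\<Gamma> c) (A c) X Y x = 0))"

text \<open>
  The connection with coefficients \<open>\<Gamma>1\<close> is \<open>\<nabla>\<^sub>X Y - \<pi>(X) AY\<close>. On a Kaehler manifold it follows that
  its torsion is \<open>\<pi>(Y) AX - \<pi>(X) AY\<close> and that \<open>g\<close> and \<open>A\<close> are parallel for it.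
\<close>

definition quarter_symmetric_metric_A_connection ::
  "('m, 'n::finite) chart set \<Rightarrow> (('m, 'n) chart \<Rightarrow> real^'n \<Rightarrow> real^'n \<Rightarrow> real^'n) \<Rightarrow>
   (('m, 'n) chart \<Rightarrow> real^'n \<Rightarrow> real^'n \<Rightarrow> real^'n \<Rightarrow> real^'n) \<Rightarrow>
   (('m, 'n) chart \<Rightarrow> real^'n \<Rightarrow> real^'n \<Rightarrow> real) \<Rightarrow>
   (('m, 'n) chart \<Rightarrow> real^'n \<Rightarrow> real^'n \<Rightarrow> real^'n \<Rightarrow> real^'n) \<Rightarrow> bool" where
  "quarter_symmetric_metric_A_connection \<A> A \<Gamma> \<pi> \<Gamma>1 \<longleftrightarrow>
     one_form \<A> \<pi> \<and> affine_connection \<A> \<Gamma>1 \<and>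
     (\<forall>c\<in>\<A>. \<forall>X Y. smooth_on (chart_image c) X \<longrightarrow> smooth_on (chart_image c) Y \<longrightarrow>
        (\<forall>x\<in>chart_image c.
           nabla (\<Gamma>1 c) X Y x = nabla (\<Gamma> c) X Y x - \<pi> c x (X x) *\<^sub>R A c x (Y x)))"


section \<open>Traces\<close>

text \<open>
  Both traces are over tangent vectors \<open>u\<close> at the point \<open>x\<close>; since the operators \<open>R\<close> they are
  applied to are tensorial, \<open>u\<close> may be extended to a vector field in any way, here to the one
  with constant components in the chart. \<open>ricci R (Y, Z) = Trace {X \<mapsto> R(X, Y)Z}\<close> and
  \<open>ricci' R (X, Y) = Trace {Z \<mapsto> R(X, Y)Z}\<close>.
\<close>

definition ricci ::
  "((real^'n::finite \<Rightarrow> real^'n) \<Rightarrow> (real^'n \<Rightarrow> real^'n) \<Rightarrow> (real^'n \<Rightarrow> real^'n) \<Rightarrow> real^'n \<Rightarrow> real^'n) \<Rightarrow>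
   (real^'n \<Rightarrow> real^'n) \<Rightarrow> (real^'n \<Rightarrow> real^'n) \<Rightarrow> real^'n \<Rightarrow> real" where
  "ricci R Y Z = (\<lambda>x. trace (matrix (\<lambda>u. R (\<lambda>_. u) Y Z x)))"

definition ricci' ::
  "((real^'n::finite \<Rightarrow> real^'n) \<Rightarrow> (real^'n \<Rightarrow> real^'n) \<Rightarrow> (real^'n \<Rightarrow> real^'n) \<Rightarrow> real^'n \<Rightarrow> real^'n) \<Rightarrow>
   (real^'n \<Rightarrow> real^'n) \<Rightarrow> (real^'n \<Rightarrow> real^'n) \<Rightarrow> real^'n \<Rightarrow> real" where
  "ricci' R X Y = (\<lambda>x. trace (matrix (\<lambda>u. R X Y (\<lambda>_. u) x)))"


section \<open>The curvature-type tensors\<close>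

text \<open>
  All tensors are again expressed in one fixed chart, in which \<open>\<Gamma>\<close> represents the Levi-Civita
  connection.
\<close>

context
  fixes A :: "real^'n::finite \<Rightarrow> real^'n \<Rightarrow> real^'n"
    and \<Gamma> :: "real^'n \<Rightarrow> real^'n \<Rightarrow> real^'n \<Rightarrow> real^'n"
    and \<pi> :: "real^'n \<Rightarrow> real^'n \<Rightarrow> real"
begin

definition app_endo :: "(real^'n \<Rightarrow> real^'n) \<Rightarrow> real^'n \<Rightarrow> real^'n" where
  "app_endo X = (\<lambda>x. A x (X x))"

definition app_form :: "(real^'n \<Rightarrow> real^'n) \<Rightarrow> real^'n \<Rightarrow> real" where
  "app_form X = (\<lambda>x. \<pi> x (X x))"

private abbreviation (input) "J \<equiv> app_endo"
private abbreviation (input) "p \<equiv> app_form"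

private abbreviation (input) "Rg \<equiv> curvature \<Gamma>"
private abbreviation (input) "Ric \<equiv> ricci Rg"

definition weyl_projective ::
  "(real^'n \<Rightarrow> real^'n) \<Rightarrow> (real^'n \<Rightarrow> real^'n) \<Rightarrow> (real^'n \<Rightarrow> real^'n) \<Rightarrow> real^'n \<Rightarrow> real^'n" where
  "weyl_projective X Y Z = (\<lambda>x.
     Rg X Y Z x + (1 / (real CARD('n) - 1)) *\<^sub>R (Ric X Z x *\<^sub>R Y x - Ric Y Z x *\<^sub>R X x))"

definition holomorphically_projective ::
  "(real^'n \<Rightarrow> real^'n) \<Rightarrow> (real^'n \<Rightarrow> real^'n) \<Rightarrow> (real^'n \<Rightarrow> real^'n) \<Rightarrow> real^'n \<Rightarrow> real^'n" where
  "holomorphically_projective X Y Z = (\<lambda>x.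
     Rg X Y Z x + (1 / (real CARD('n) + 2)) *\<^sub>R (Ric X Z x *\<^sub>R Y x - Ric Y Z x *\<^sub>R X x)
     - (1 / (real CARD('n) + 2)) *\<^sub>R (Ric X (J Z) x *\<^sub>R J Y x - Ric Y (J Z) x *\<^sub>R J X x
                        + (2 * Ric X (J Y) x) *\<^sub>R J Z x))"

definition D0 :: "(real^'n \<Rightarrow> real^'n) \<Rightarrow> (real^'n \<Rightarrow> real^'n) \<Rightarrow> real^'n \<Rightarrow> real" where
  "D0 X Y = (\<lambda>x. nabla_form \<Gamma> \<pi> X Y x + 1/2 * p X x * p (J Y) x + 1/2 * p Y x * p (J X) x)"

definition D1 :: "(real^'n \<Rightarrow> real^'n) \<Rightarrow> (real^'n \<Rightarrow> real^'n) \<Rightarrow> real^'n \<Rightarrow> real" where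
  "D1 X Y = (\<lambda>x. nabla_form \<Gamma> \<pi> X Y x - nabla_form \<Gamma> \<pi> Y X x)"

definition D2 :: "(real^'n \<Rightarrow> real^'n) \<Rightarrow> (real^'n \<Rightarrow> real^'n) \<Rightarrow> real^'n \<Rightarrow> real" where
  "D2 X Y = (\<lambda>x. nabla_form \<Gamma> \<pi> X Y x + p Y x * p (J X) x)"

definition D3 :: "(real^'n \<Rightarrow> real^'n) \<Rightarrow> (real^'n \<Rightarrow> real^'n) \<Rightarrow> real^'n \<Rightarrow> real" where
  "D3 X Y = (\<lambda>x. nabla_form \<Gamma> \<pi> X Y x + p X x * p (J Y) x)"

definition R0 ::
  "(real^'n \<Rightarrow> real^'n) \<Rightarrow> (real^'n \<Rightarrow> real^'n) \<Rightarrow> (real^'n \<Rightarrow> real^'n) \<Rightarrow> real^'n \<Rightarrow> real^'n" where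
  "R0 X Y Z = (\<lambda>x.
     Rg X Y Z x - (1/2 * (D0 X Y x - D0 Y X x)) *\<^sub>R J Z x
     - (1/2 * D0 X Z x) *\<^sub>R J Y x + (1/2 * D0 Y Z x) *\<^sub>R J X x
     + (1/4 * p Z x) *\<^sub>R (p Y x *\<^sub>R X x - p X x *\<^sub>R Y x))"

definition R1 ::
  "(real^'n \<Rightarrow> real^'n) \<Rightarrow> (real^'n \<Rightarrow> real^'n) \<Rightarrow> (real^'n \<Rightarrow> real^'n) \<Rightarrow> real^'n \<Rightarrow> real^'n" where
  "R1 X Y Z = (\<lambda>x. Rg X Y Z x - D1 X Y x *\<^sub>R J Z x)"

definition R3 ::
  "(real^'n \<Rightarrow> real^'n) \<Rightarrow> (real^'n \<Rightarrow> real^'n) \<Rightarrow> (real^'n \<Rightarrow> real^'n) \<Rightarrow> real^'n \<Rightarrow> real^'n" where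
  "R3 X Y Z = (\<lambda>x. Rg X Y Z x - D2 X Y x *\<^sub>R J Z x + D3 Y Z x *\<^sub>R J X x)"

private abbreviation (input) "Ric0 \<equiv> ricci R0"
private abbreviation (input) "Ric1 \<equiv> ricci R1"
private abbreviation (input) "Ric3 \<equiv> ricci R3"
private abbreviation (input) "Ric3' \<equiv> ricci' R3"

definition H0 ::
  "(real^'n \<Rightarrow> real^'n) \<Rightarrow> (real^'n \<Rightarrow> real^'n) \<Rightarrow> (real^'n \<Rightarrow> real^'n) \<Rightarrow> real^'n \<Rightarrow> real^'n" where
  "H0 X Y Z = (\<lambda>x.
     R0 X Y Z x
     + (1 / (real CARD('n) - 1)) *\<^sub>R (Ric0 X Z x *\<^sub>R Y x - Ric0 Y Z x *\<^sub>R X x)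
     - (1 / (2 * (real CARD('n) - 1))) *\<^sub>R (Ric1 X Z x *\<^sub>R Y x - Ric1 Y Z x *\<^sub>R X x)
     - (1 / (4 * (real CARD('n) - 1))) *\<^sub>R
         (Ric3 Z X x *\<^sub>R Y x - Ric3 Z Y x *\<^sub>R X x
          + Ric3' (J Z) (J X) x *\<^sub>R Y x - Ric3' (J Z) (J Y) x *\<^sub>R X x)
     + (1/4) *\<^sub>R
         ((2 * Ric1 Y (J X) x) *\<^sub>R J Z x + Ric3 Z (J X) x *\<^sub>R J Y x - Ric3 Z (J Y) x *\<^sub>R J X x)
     - (1/4) *\<^sub>R (Ric3' (J Z) X x *\<^sub>R J Y x - Ric3' (J Z) Y x *\<^sub>R J X x))"

end

end

theory Submission
  imports Defs
begin

text \<open>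
  Evaluating the traces at a point, all terms of \<open>H0\<close> that involve \<open>\<pi>\<close> cancel, and with
  \<open>Ric\<close> symmetric and \<open>Ric(AX, Z) = - Ric(X, AZ)\<close> one is left with
  \<open>H0(X, Y)Z = R(X, Y)Z + (Ric(X, Z)Y - Ric(Y, Z)X) / (4(n - 1))
    - (Ric(X, AZ)AY - Ric(Y, AZ)AX + 2 Ric(X, AY)AZ) / 4\<close>.
  If this vanishes, the last bracket can be eliminated from \<open>P\<close>, which leaves a multiple of \<open>W\<close>.
\<close>

subsection \<open>Calculus of smooth maps\<close>

text \<open>The traces extend a tangent vector by constant components in the chart, so every
  operator has to be known as tensorial before a trace can be evaluated. For
  \<open>curvature\<close> this rests on the symmetry of mixed second derivatives, which also yields
  the skewness of the curvature endomorphism with respect to \<open_placeholder>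

  Restarting cleanly; the complete list follows.\<close>

lemma Ck_on_cong:
  assumes "open S" "\<And>x. x \<in> S \<Longrightarrow> f x = g x"
  shows "Ck_on k S f \<longleftrightarrow> Ck_on k S g"
  using assms(2)
proof (induction k arbitrary: f g)
  case 0
  then show ?case by (simp cong: continuous_on_cong)
next
  case (Suc k)
  have *: "frechet_derivative f (at x) = frechet_derivative g (at x)"
    and **: "f differentiable (at x) \<longleftrightarrow> g differentiable (at x)" if "x \<in> S" for x
  proof -
    \<comment> \<open>A derivative at a point of an open set depends only on the values in that
      set.\<close>
    have e: "(f has_derivative f') (at x) \<longleftrightarrow> (g has_derivative f') (at x)" for f'
      using has_derivative_transform_within_open[OF _ assms(1) that] Suc.prems by metis
    then show "frechet_derivative f (at x) = frechet_derivative g (at x)"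
      by (simp add: frechet_derivative_def)
    show "f differentiable (at x) \<longleftrightarrow> g differentiable (at x)"
      by (simp add: differentiable_def e)
  qed
  have "Ck_on k S (\<lambda>x. frechet_derivative f (at x) v) \<longleftrightarrow>
        Ck_on k S (\<lambda>x. frechet_derivative g (at x) v)" for v
    by (rule Suc.IH) (simp add: *)
  then show ?case by (simp add: **)
qed

lemma Ck_on_SucD: "Ck_on (Suc k) S f \<Longrightarrow> Ck_on k S f"
proof (induction k arbitrary: f)
  case 0
  then show ?case
    by (auto intro!: differentiable_imp_continuous_on differentiable_at_imp_differentiable_on)
qed auto

lemma Ck_on_const: "Ck_on k S (\<lambda>x. c)"
  by (induction k arbitrary: c) auto

lemma frechet_derivative_add:
  assumes "f differentiable (at x)" "g differentiable (at x)"
  shows "frechet_derivative (\<lambda>y. f y + g y) (at x) v =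
         frechet_derivative f (at x) v + frechet_derivative g (at x) v"
proof -
  have "((\<lambda>y. f y + g y) has_derivative
      (\<lambda>v. frechet_derivative f (at x) v + frechet_derivative g (at x) v)) (at x)"
    using assms by (intro has_derivative_add) (simp_all add: frechet_derivative_works)
  from frechet_derivative_at[OF this, symmetric] show ?thesis by simp
qed

lemma frechet_derivative_bilinear:
  assumes "bounded_bilinear B" "f differentiable (at x)" "g differentiable (at x)"
  shows "(\<lambda>y. B (f y) (g y)) differentiable (at x)"
    and "frechet_derivative (\<lambda>y. B (f y) (g y)) (at x) v =
         B (f x) (frechet_derivative g (at x) v) + B (frechet_derivative f (at x) v) (g x)"
proof -
  have D: "((\<lambda>y. B (f y) (g y)) has_derivative (\<lambda>v. B (f x) (frechet_derivative g (at x) v) +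
      B (frechet_derivative f (at x) v) (g x))) (at x)"
    using assms by (intro bounded_bilinear.FDERIV) (simp_all add: frechet_derivative_works)
  then show "(\<lambda>y. B (f y) (g y)) differentiable (at x)"
    unfolding differentiable_def by blast
  show "frechet_derivative (\<lambda>y. B (f y) (g y)) (at x) v =
         B (f x) (frechet_derivative g (at x) v) + B (frechet_derivative f (at x) v) (g x)"
    by (simp flip: frechet_derivative_at[OF D])
qed

lemma frechet_derivative_bounded_linear:
  assumes "bounded_linear L" "f differentiable (at x)"
  shows "(\<lambda>y. L (f y)) differentiable (at x)"
    and "frechet_derivative (\<lambda>y. L (f y)) (at x) v = L (frechet_derivative f (at x) v)"
proof -
  have D: "((\<lambda>y. L (f y)) has_derivative (\<lambda>v. L (frechet_derivative f (at x) v))) (at x)"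
    using assms by (auto intro!: bounded_linear.has_derivative[OF assms(1)] simp: frechet_derivative_works)
  then show "(\<lambda>y. L (f y)) differentiable (at x)"
    unfolding differentiable_def by blast
  show "frechet_derivative (\<lambda>y. L (f y)) (at x) v = L (frechet_derivative f (at x) v)"
    by (simp flip: frechet_derivative_at[OF D])
qed

lemma Ck_on_add:
  assumes "open S" "Ck_on k S f" "Ck_on k S g"
  shows "Ck_on k S (\<lambda>x. f x + g x)"
  using assms(2,3)
proof (induction k arbitrary: f g)
  case (Suc k)
  have "Ck_on k S (\<lambda>x. frechet_derivative (\<lambda>x. f x + g x) (at x) v)" for v
    using Suc.prems Suc.IH[of "\<lambda>x. frechet_derivative f (at x) v" "\<lambda>x. frechet_derivative g (at x) v"]
    by (subst Ck_on_cong[OF assms(1), of _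
        "\<lambda>x. frechet_derivative f (at x) v + frechet_derivative g (at x) v"])
      (auto simp: frechet_derivative_add)
  with Suc.prems show ?case by auto
qed (auto intro: continuous_intros)

lemma Ck_on_bilinear:
  assumes "bounded_bilinear B" "open S" "Ck_on k S f" "Ck_on k S g"
  shows "Ck_on k S (\<lambda>x. B (f x) (g x))"
  using assms(3,4)
proof (induction k arbitrary: f g)
  case 0
  then show ?case by (auto intro: bounded_bilinear.continuous_on[OF assms(1)])
next
  case (Suc k)
  note D = frechet_derivative_bilinear[OF assms(1)]
  have "Ck_on k S (\<lambda>x. frechet_derivative (\<lambda>x. B (f x) (g x)) (at x) v)" for v
  proof (subst Ck_on_cong[OF assms(2)])
    show "frechet_derivative (\<lambda>x. B (f x) (g x)) (at x) v = B (f x) (frechet_derivative g (at x) v) +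
        B (frechet_derivative f (at x) v) (g x)" if "x \<in> S" for x
      using that Suc.prems by (intro D) auto
    show "Ck_on k S (\<lambda>x. B (f x) (frechet_derivative g (at x) v) +
        B (frechet_derivative f (at x) v) (g x))"
      \<comment> \<open>The Leibniz rule leaves one factor undifferentiated; it is of class
        \<open>Suc k\<close> and has to be weakened to \<open>k\<close> before the induction
        hypothesis applies.\<close>
      using Suc.prems
      by (intro Ck_on_add assms Suc.IH) (auto intro: Ck_on_SucD)
  qed
  with Suc.prems show ?case by (auto intro: D(1))
qed

lemma Ck_on_bounded_linear:
  assumes "bounded_linear L" "open S" "Ck_on k S f"
  shows "Ck_on k S (\<lambda>x. L (f x))"
  using assms(3)
proof (induction k arbitrary: f)
  case 0
  then show ?case by (auto intro: bounded_linear.continuous_on[OF assms(1)])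
next
  case (Suc k)
  note D = frechet_derivative_bounded_linear[OF assms(1)]
  have "Ck_on k S (\<lambda>x. frechet_derivative (\<lambda>x. L (f x)) (at x) v)" for v
    using Suc.prems Suc.IH[of "\<lambda>x. frechet_derivative f (at x) v"]
    by (subst Ck_on_cong[OF assms(2), of _ "\<lambda>x. L (frechet_derivative f (at x) v)"])
      (auto simp: D)
  with Suc.prems show ?case by (auto intro: D(1))
qed

lemma smooth_on_const: "smooth_on S (\<lambda>x. c)"
  by (simp add: smooth_on_def Ck_on_const)

lemma smooth_on_add:
  "open S \<Longrightarrow> smooth_on S f \<Longrightarrow> smooth_on S g \<Longrightarrow> smooth_on S (\<lambda>x. f x + g x)"
  by (simp add: smooth_on_def Ck_on_add)

lemma smooth_on_sum:
  "open S \<Longrightarrow> (\<And>i. i \<in> I \<Longrightarrow> smooth_on S (f i)) \<Longrightarrow> smooth_on S (\<lambda>x. \<Sum>i\<in>I. f i x)"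
  by (induction I rule: infinite_finite_induct) (auto intro: smooth_on_const smooth_on_add)

lemma smooth_on_differentiable: "smooth_on S f \<Longrightarrow> x \<in> S \<Longrightarrow> f differentiable (at x)"
  unfolding smooth_on_def by (auto dest: spec[where x = 1])

lemma smooth_on_frechet_derivative:
  "smooth_on S f \<Longrightarrow> smooth_on S (\<lambda>x. frechet_derivative f (at x) v)"
  unfolding smooth_on_def
proof
  fix k
  assume "\<forall>k. Ck_on k S f"
  then have "Ck_on (Suc k) S f" ..
  then show "Ck_on k S (\<lambda>x. frechet_derivative f (at x) v)" by simp
qed

lemma smooth_on_continuous: "smooth_on S f \<Longrightarrow> continuous_on S f"
  unfolding smooth_on_def by (auto dest: spec[where x = 0])

lemma smooth_on_cong:
  "open S \<Longrightarrow> (\<And>x. x \<in> S \<Longrightarrow> f x = g x) \<Longrightarrow> smooth_on S f \<longleftrightarrow> smooth_on S g"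
  unfolding smooth_on_def by (simp cong: Ck_on_cong)

lemma smooth_on_bounded_linear:
  "bounded_linear L \<Longrightarrow> open S \<Longrightarrow> smooth_on S f \<Longrightarrow> smooth_on S (\<lambda>x. L (f x))"
  unfolding smooth_on_def by (blast intro: Ck_on_bounded_linear)

lemma smooth_on_scaleR:
  "open S \<Longrightarrow> smooth_on S f \<Longrightarrow> smooth_on S g \<Longrightarrow> smooth_on S (\<lambda>x. f x *\<^sub>R g x)"
  unfolding smooth_on_def by (blast intro: Ck_on_bilinear[OF bounded_bilinear_scaleR])

section \<open>Symmetry of mixed second derivatives\<close>

text \<open>Two applications of the mean value theorem, along \<open>u\<close> and then along
  \<open>v\<close>, turn the second difference over a parallelogram into a mixed derivative at an
  interior point. Only the order of the two directions on the right depends on the order of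
  \<open>u\<close> and \<open>v\<close>.\<close>

lemma second_difference_mvt:
  fixes f :: "'a::real_normed_vector \<Rightarrow> real"
  assumes "smooth_on S f" "0 < s"
    and S: "\<And>a b. 0 \<le> a \<Longrightarrow> a \<le> s \<Longrightarrow> 0 \<le> b \<Longrightarrow> b \<le> s \<Longrightarrow> x + a *\<^sub>R u + b *\<^sub>R v \<in> S"
  shows "\<exists>a\<in>{0<..<s}. \<exists>b\<in>{0<..<s}.
    f (x + s *\<^sub>R u + s *\<^sub>R v) - f (x + s *\<^sub>R u) - f (x + s *\<^sub>R v) + f x =
    s * s * frechet_derivative (\<lambda>y. frechet_derivative f (at y) u) (at (x + a *\<^sub>R u + b *\<^sub>R v)) v"
proof -
  have line: "((\<lambda>t. h (p + t *\<^sub>R w)) has_real_derivative frechet_derivative h (at (p + t *\<^sub>R w)) w) (at t)"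
    if h: "smooth_on S h" "p + t *\<^sub>R w \<in> S" for h :: "'a \<Rightarrow> real" and p w t
  proof -
    have d: "(h has_derivative frechet_derivative h (at (p + t *\<^sub>R w))) (at (p + t *\<^sub>R w))"
      using smooth_on_differentiable[OF h] by (simp add: frechet_derivative_works)
    have "((\<lambda>t. p + t *\<^sub>R w) has_derivative (\<lambda>r. r *\<^sub>R w)) (at t)"
      by (auto intro!: derivative_eq_intros)
    from has_derivative_compose[OF this d]
    have "((\<lambda>t. h (p + t *\<^sub>R w)) has_derivative
        (\<lambda>r. frechet_derivative h (at (p + t *\<^sub>R w)) (r *\<^sub>R w))) (at t)" .
    moreover have "frechet_derivative h (at (p + t *\<^sub>R w)) (r *\<^sub>R w) =
        frechet_derivative h (at (p + t *\<^sub>R w)) w * r" for r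
      using linear_frechet_derivative[OF smooth_on_differentiable[OF h]]
      by (simp add: linear_cmul)
    ultimately show ?thesis
      by (simp add: has_field_derivative_def)
  qed
  define F where "F y = frechet_derivative f (at y) u" for y
  have F: "smooth_on S F"
    unfolding F_def using assms(1) by (rule smooth_on_frechet_derivative)
  \<comment> \<open>The difference across the side \<open>s *\<^sub>R v\<close>, as a function of
    the position along \<open>u\<close>; its increment over [0, s] is the second difference.\<close>
  define \<phi> where "\<phi> a = f ((x + s *\<^sub>R v) + a *\<^sub>R u) - f (x + a *\<^sub>R u)" for a
  have inS: "x + s *\<^sub>R v + a *\<^sub>R u \<in> S" "x + a *\<^sub>R u \<in> S" if "0 \<le> a" "a \<le> s" for a
    using S[of a s] S[of a 0] that by (simp_all add: ac_simps)
  have "\<exists>a>0. a < s \<and> \<phi> s - \<phi> 0 = (s - 0) * (F ((x + s *\<^sub>R v) + a *\<^sub>R u) - F (x + a *\<^sub>R u))"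
    unfolding \<phi>_def F_def
    using assms(2) inS by (intro MVT2 DERIV_diff line assms(1)) auto
  then obtain a where a: "0 < a" "a < s"
    "\<phi> s - \<phi> 0 = s * (F ((x + s *\<^sub>R v) + a *\<^sub>R u) - F (x + a *\<^sub>R u))" by auto
  have "\<exists>b>0. b < s \<and> F ((x + a *\<^sub>R u) + s *\<^sub>R v) - F ((x + a *\<^sub>R u) + 0 *\<^sub>R v) =
      (s - 0) * frechet_derivative F (at ((x + a *\<^sub>R u) + b *\<^sub>R v)) v"
    using S[of a] a assms(2)
    by (intro MVT2) (auto intro!: line F)
  then obtain b where b: "0 < b" "b < s" "F ((x + a *\<^sub>R u) + s *\<^sub>R v) - F (x + a *\<^sub>R u) =
      s * frechet_derivative F (at ((x + a *\<^sub>R u) + b *\<^sub>R v)) v" by auto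
  have "f (x + s *\<^sub>R u + s *\<^sub>R v) - f (x + s *\<^sub>R u) - f (x + s *\<^sub>R v) + f x = \<phi> s - \<phi> 0"
    by (simp add: \<phi>_def algebra_simps)
  also have "\<dots> = s * s * frechet_derivative F (at (x + a *\<^sub>R u + b *\<^sub>R v)) v"
    using a(3) b(3) by (simp add: algebra_simps)
  finally show ?thesis
    using a b unfolding F_def by fastforce
qed

text \<open>The second difference is symmetric in \<open>u\<close> and \<open>v\<close>, so on
  arbitrarily small parallelograms the two mixed derivatives take a common value, though at
  different points. Continuity of both at \<open>x\<close> then forces equality there.\<close>

lemma symmetric_second_derivative_real:
  fixes f :: "'a::real_normed_vector \<Rightarrow> real"
  assumes "open S" "x \<in> S" "smooth_on S f"
  shows "frechet_derivative (\<lambda>y. frechet_derivative f (at y) u) (at x) v =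
         frechet_derivative (\<lambda>y. frechet_derivative f (at y) v) (at x) u" (is "?P x = ?Q x")
proof (rule ccontr)
  assume ne: "?P x \<noteq> ?Q x"
  define e where "e = dist (?P x) (?Q x) / 2"
  have e: "e > 0" using ne by (simp add: e_def)
  have "isCont ?P x" "isCont ?Q x"
    using assms smooth_on_continuous[OF smooth_on_frechet_derivative[OF smooth_on_frechet_derivative[OF assms(3)]]]
    by (auto simp: continuous_on_eq_continuous_at)
  then obtain d1 d2 where d1: "d1 > 0" "\<And>y. dist y x < d1 \<Longrightarrow> dist (?P y) (?P x) < e"
    and d2: "d2 > 0" "\<And>y. dist y x < d2 \<Longrightarrow> dist (?Q y) (?Q x) < e"
    using e unfolding continuous_at_eps_delta by metis
  obtain d3 where d3: "d3 > 0" "ball x d3 \<subseteq> S"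
    using assms openE by blast
  define d where "d = min d1 (min d2 d3)"
  have d: "d > 0" using d1 d2 d3 by (simp add: d_def)
  \<comment> \<open>Small enough to keep the whole parallelogram within distance \<open>d\<close> of
    \<open>x\<close>; the summand 1 keeps the denominator positive when \<open>u\<close> and
    \<open>v\<close> are both zero.\<close>
  define s where "s = d / (2 * (norm u + norm v + 1))"
  have nn: "norm u + norm v + 1 > 0"
    using norm_ge_zero[of u] norm_ge_zero[of v] by linarith
  have s: "s > 0"
    unfolding s_def using d nn by (intro divide_pos_pos) auto
  have near: "dist (x + a *\<^sub>R u + b *\<^sub>R v) x < d" if "0 \<le> a" "a \<le> s" "0 \<le> b" "b \<le> s" for a b
  proof -
    have "dist (x + a *\<^sub>R u + b *\<^sub>R v) x = norm (a *\<^sub>R u + b *\<^sub>R v)"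
      by (simp add: dist_norm)
    also have "\<dots> \<le> norm (a *\<^sub>R u) + norm (b *\<^sub>R v)"
      by (rule norm_triangle_ineq)
    also have "\<dots> \<le> s * norm u + s * norm v"
      using that by (auto intro!: add_mono mult_right_mono)
    also have "\<dots> < 2 * (s * (norm u + norm v + 1))"
    proof -
      have "0 \<le> s * norm u" "0 \<le> s * norm v" using s by auto
      then show ?thesis using s unfolding distrib_left by linarith
    qed
    also have "\<dots> = d"
    proof -
      have "2 * (d / (2 * m) * m) = d" if "m > 0" for m :: real
        using that by simp
      from this[OF nn] show ?thesis unfolding s_def .
    qed
    finally show ?thesis .
  qed
  have inS: "x + a *\<^sub>R u + b *\<^sub>R v \<in> S" if "0 \<le> a" "a \<le> s" "0 \<le> b" "b \<le> s" for a b
    using near[OF that] d3 by (auto simp: d_def dist_commute subset_iff)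
  have inS': "x + a *\<^sub>R v + b *\<^sub>R u \<in> S" if "0 \<le> a" "a \<le> s" "0 \<le> b" "b \<le> s" for a b
    using inS[of b a] that by (simp add: algebra_simps)
  let ?D = "f (x + s *\<^sub>R u + s *\<^sub>R v) - f (x + s *\<^sub>R u) - f (x + s *\<^sub>R v) + f x"
  obtain a b where ab: "a \<in> {0<..<s}" "b \<in> {0<..<s}" "?D = s * s * ?P (x + a *\<^sub>R u + b *\<^sub>R v)"
    using second_difference_mvt[OF assms(3) s inS] by blast
  obtain a' b' where ab': "a' \<in> {0<..<s}" "b' \<in> {0<..<s}"
    "f (x + s *\<^sub>R v + s *\<^sub>R u) - f (x + s *\<^sub>R v) - f (x + s *\<^sub>R u) + f x =
     s * s * ?Q (x + a' *\<^sub>R v + b' *\<^sub>R u)"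
    using second_difference_mvt[OF assms(3) s inS'] by blast
  have "s * s * ?P (x + a *\<^sub>R u + b *\<^sub>R v) = s * s * ?Q (x + b' *\<^sub>R u + a' *\<^sub>R v)"
    using ab(3) ab'(3) by (simp add: algebra_simps)
  then have "?P (x + a *\<^sub>R u + b *\<^sub>R v) = ?Q (x + b' *\<^sub>R u + a' *\<^sub>R v)"
    using s by simp
  moreover have "dist (?P (x + a *\<^sub>R u + b *\<^sub>R v)) (?P x) < e"
    using near[of a b] ab by (intro d1(2)) (auto simp: d_def)
  moreover have "dist (?Q (x + b' *\<^sub>R u + a' *\<^sub>R v)) (?Q x) < e"
    using near[of b' a'] ab' by (intro d2(2)) (auto simp: d_def)
  \<comment> \<open>The common value is closer than half the gap to both \<open>?P x\<close> and
    \<open>?Q x\<close>.\<close>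
  ultimately show False
    unfolding e_def by (metis dist_triangle_half_r less_irrefl)
qed

text \<open>Pairing with a fixed vector \<open>b\<close> is linear, hence commutes with
  differentiation and reduces the claim to real-valued functions; a vector is determined by all its
  inner products.\<close>

lemma symmetric_second_derivative:
  fixes f :: "'a::real_normed_vector \<Rightarrow> 'b::real_inner"
  assumes "open S" "x \<in> S" "smooth_on S f"
  shows "frechet_derivative (\<lambda>y. frechet_derivative f (at y) u) (at x) v =
         frechet_derivative (\<lambda>y. frechet_derivative f (at y) v) (at x) u"
proof -
  have inner: "frechet_derivative (\<lambda>y. frechet_derivative (\<lambda>z. f z \<bullet> b) (at y) u) (at x) v =
      frechet_derivative (\<lambda>y. frechet_derivative f (at y) u) (at x) v \<bullet> b" for b u v
  proof -
    note D = frechet_derivative_bounded_linear(2)[OF bounded_linear_inner_left[of b]]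
    have "frechet_derivative (\<lambda>y. frechet_derivative (\<lambda>z. f z \<bullet> b) (at y) u) (at x) =
        frechet_derivative (\<lambda>y. frechet_derivative f (at y) u \<bullet> b) (at x)"
    proof (rule sym, rule frechet_derivative_transform_within_open[OF _ assms(1,2)])
      show "(\<lambda>y. frechet_derivative f (at y) u \<bullet> b) differentiable (at x)"
        using smooth_on_differentiable[OF smooth_on_frechet_derivative[OF assms(3)] assms(2)]
        by (rule frechet_derivative_bounded_linear(1)[OF bounded_linear_inner_left])
    qed (simp add: D smooth_on_differentiable[OF assms(3)])
    moreover have "frechet_derivative (\<lambda>y. frechet_derivative f (at y) u \<bullet> b) (at x) v =
        frechet_derivative (\<lambda>y. frechet_derivative f (at y) u) (at x) v \<bullet> b"
      by (rule D[OF smooth_on_differentiable[OF smooth_on_frechet_derivative[OF assms(3)] assms(2)]])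
    ultimately show ?thesis by simp
  qed
  have "smooth_on S (\<lambda>z. f z \<bullet> b)" for b
    using assms by (intro smooth_on_bounded_linear[OF bounded_linear_inner_left])
  from symmetric_second_derivative_real[OF assms(1,2) this]
  show ?thesis
    unfolding inner by (metis vector_eq_rdot)
qed

subsection \<open>Coordinate expression of the curvature\<close>

lemma linear_euclidean_expansion:
  fixes L :: "'a::euclidean_space \<Rightarrow> 'b::real_vector"
  assumes "linear L"
  shows "L z = (\<Sum>b\<in>Basis. (z \<bullet> b) *\<^sub>R L b)"
proof -
  have "L z = L (\<Sum>b\<in>Basis. (z \<bullet> b) *\<^sub>R b)"
    by (simp add: euclidean_representation)
  then show ?thesis
    using assms by (simp add: linear_sum linear_cmul)
qed

text \<open>Tensor fields are only assumed smooth on constant arguments. Expanding the argument in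
  the finite basis reduces a varying argument to these.\<close>

lemma smooth_on_apply:
  fixes Z :: "'c::real_normed_vector \<Rightarrow> 'a::euclidean_space"
  assumes "open S" "\<And>x. x \<in> S \<Longrightarrow> linear (L x)" "\<And>u. smooth_on S (\<lambda>x. L x u)" "smooth_on S Z"
  shows "smooth_on S (\<lambda>x. L x (Z x))"
proof (subst smooth_on_cong[OF assms(1)])
  show "L x (Z x) = (\<Sum>b\<in>Basis. (Z x \<bullet> b) *\<^sub>R L x b)" if "x \<in> S" for x
    by (rule linear_euclidean_expansion[OF assms(2)[OF that]])
  show "smooth_on S (\<lambda>x. \<Sum>b\<in>Basis. (Z x \<bullet> b) *\<^sub>R L x b)"
    using assms
    by (intro smooth_on_sum smooth_on_scaleR smooth_on_bounded_linear[OF bounded_linear_inner_left])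
qed

lemma has_derivative_apply:
  fixes Z :: "'c::real_normed_vector \<Rightarrow> 'a::euclidean_space"
  assumes "open S" "x \<in> S" and lin: "\<And>y. y \<in> S \<Longrightarrow> linear (L y)"
    and L: "\<And>w. (\<lambda>y. L y w) differentiable (at x)" and Z: "Z differentiable (at x)"
  shows "((\<lambda>y. L y (Z y)) has_derivative (\<lambda>u. frechet_derivative (\<lambda>y. L y (Z x)) (at x) u +
           L x (frechet_derivative Z (at x) u))) (at x)"
proof -
  have sum: "((\<lambda>y. L y (W y)) has_derivative (\<lambda>u. (\<Sum>b\<in>Basis.
        (W x \<bullet> b) *\<^sub>R frechet_derivative (\<lambda>y. L y b) (at x) u) + L x (W' u))) (at x)"
    if W: "(W has_derivative W') (at x)" for W W'
  proof -
    have "((\<lambda>y. \<Sum>b\<in>Basis. (W y \<bullet> b) *\<^sub>R L y b) has_derivative (\<lambda>u. \<Sum>b\<in>Basis.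
        (W x \<bullet> b) *\<^sub>R frechet_derivative (\<lambda>y. L y b) (at x) u + (W' u \<bullet> b) *\<^sub>R L x b)) (at x)"
      using L by (intro has_derivative_sum has_derivative_scaleR has_derivative_inner_left W)
        (simp add: frechet_derivative_works)
    then have "((\<lambda>y. L y (W y)) has_derivative (\<lambda>u. \<Sum>b\<in>Basis.
        (W x \<bullet> b) *\<^sub>R frechet_derivative (\<lambda>y. L y b) (at x) u + (W' u \<bullet> b) *\<^sub>R L x b)) (at x)"
      by (rule has_derivative_transform_within_open[OF _ assms(1,2)])
        (simp add: linear_euclidean_expansion[OF lin, symmetric])
    then show ?thesis
      by (simp add: sum.distrib linear_euclidean_expansion[OF lin[OF assms(2)], symmetric])
  qed
  have "frechet_derivative (\<lambda>y. L y (Z x)) (at x) =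
      (\<lambda>u. \<Sum>b\<in>Basis. (Z x \<bullet> b) *\<^sub>R frechet_derivative (\<lambda>y. L y b) (at x) u)"
    using frechet_derivative_at[OF sum[OF has_derivative_const[of "Z x"]], symmetric]
    by (simp add: linear_0[OF lin[OF assms(2)]])
  with sum[OF Z[unfolded frechet_derivative_works]] show ?thesis by simp
qed

lemma linear_frechet_derivative_param:
  fixes L :: "'c::real_normed_vector \<Rightarrow> 'a::real_normed_vector \<Rightarrow> 'b::real_normed_vector"
  assumes "open S" "x \<in> S" and lin: "\<And>y. y \<in> S \<Longrightarrow> linear (L y)"
    and L: "\<And>w. (\<lambda>y. L y w) differentiable (at x)"
  shows "linear (\<lambda>w. frechet_derivative (\<lambda>y. L y w) (at x) u)"
proof
  fix v w r
  have "frechet_derivative (\<lambda>y. L y v + L y w) (at x) = frechet_derivative (\<lambda>y. L y (v + w)) (at x)"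
    using L by (intro frechet_derivative_transform_within_open[OF _ assms(1,2)])
      (auto simp: linear_add[OF lin] intro: differentiable_add)
  then show "frechet_derivative (\<lambda>y. L y (v + w)) (at x) u =
      frechet_derivative (\<lambda>y. L y v) (at x) u + frechet_derivative (\<lambda>y. L y w) (at x) u"
    using frechet_derivative_add[OF L L] by metis
  note scale = frechet_derivative_bounded_linear[OF bounded_linear_scaleR_right L]
  have "frechet_derivative (\<lambda>y. r *\<^sub>R L y v) (at x) = frechet_derivative (\<lambda>y. L y (r *\<^sub>R v)) (at x)"
    by (intro frechet_derivative_transform_within_open[OF _ assms(1,2)] scale(1))
      (simp add: linear_cmul[OF lin])
  then show "frechet_derivative (\<lambda>y. L y (r *\<^sub>R v)) (at x) u =
      r *\<^sub>R frechet_derivative (\<lambda>y. L y v) (at x) u"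
    using scale(2) by metis
qed

text \<open>The one-argument product rule used twice: first in the first slot with the second
  frozen, then in the second slot.\<close>

lemma has_derivative_apply2:
  fixes Y :: "'c::real_normed_vector \<Rightarrow> 'a::euclidean_space" and Z :: "'c \<Rightarrow> 'd::euclidean_space"
  assumes "open S" "x \<in> S" and bil: "\<And>y. y \<in> S \<Longrightarrow> bilinear (G y)"
    and G: "\<And>v w. (\<lambda>y. G y v w) differentiable (at x)"
    and Y: "Y differentiable (at x)" and Z: "Z differentiable (at x)"
  shows "((\<lambda>y. G y (Y y) (Z y)) has_derivative (\<lambda>u.
           frechet_derivative (\<lambda>y. G y (Y x) (Z x)) (at x) u +
           G x (frechet_derivative Y (at x) u) (Z x) + G x (Y x) (frechet_derivative Z (at x) u))) (at x)"
proof -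
  have l: "linear (\<lambda>v. G y v w)" and r: "linear (G y v)" if "y \<in> S" for y v w
    using bil[OF that] by (auto simp: bilinear_def)
  have *: "((\<lambda>y. G y (Y y) w) has_derivative (\<lambda>u. frechet_derivative (\<lambda>y. G y (Y x) w) (at x) u +
           G x (frechet_derivative Y (at x) u) w)) (at x)" for w
    using has_derivative_apply[OF assms(1,2) l G Y] .
  from has_derivative_apply[OF assms(1,2) r differentiableI[OF *] Z]
  show ?thesis
    unfolding frechet_derivative_at[OF *, symmetric] by simp
qed

lemma smooth_on_apply2:
  fixes Y :: "'c::real_normed_vector \<Rightarrow> 'a::euclidean_space" and Z :: "'c \<Rightarrow> 'd::euclidean_space"
  assumes "open S" and bil: "\<And>y. y \<in> S \<Longrightarrow> bilinear (G y)"
    and "\<And>v w. smooth_on S (\<lambda>y. G y v w)" "smooth_on S Y" "smooth_on S Z"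
  shows "smooth_on S (\<lambda>y. G y (Y y) (Z y))"
proof (rule smooth_on_apply[OF assms(1) _ _ assms(5)])
  show "linear (G x (Y x))" if "x \<in> S" for x
    using bil[OF that] by (simp add: bilinear_def)
  show "smooth_on S (\<lambda>x. G x (Y x) w)" for w
    by (rule smooth_on_apply[OF assms(1) _ assms(3,4)]) (use bil in \<open>simp add: bilinear_def\<close>)
qed

text \<open>The classical coordinate formula: the curvature on fields with constant components,
  whose Lie bracket vanishes.\<close>

definition curvature_tensor ::
  "(real^'n::finite \<Rightarrow> real^'n \<Rightarrow> real^'n \<Rightarrow> real^'n) \<Rightarrow> real^'n \<Rightarrow>
   real^'n \<Rightarrow> real^'n \<Rightarrow> real^'n \<Rightarrow> real^'n" where
  "curvature_tensor \<Gamma> x u v w =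
     frechet_derivative (\<lambda>y. \<Gamma> y v w) (at x) u - frechet_derivative (\<lambda>y. \<Gamma> y u w) (at x) v
     + \<Gamma> x u (\<Gamma> x v w) - \<Gamma> x v (\<Gamma> x u w)"

locale local_connection =
  fixes S :: "(real^'n::finite) set" and \<Gamma> :: "real^'n \<Rightarrow> real^'n \<Rightarrow> real^'n \<Rightarrow> real^'n"
  assumes open_S: "open S"
    and bilinear_\<Gamma>: "x \<in> S \<Longrightarrow> bilinear (\<Gamma> x)"
    and smooth_\<Gamma>: "smooth_on S (\<lambda>x. \<Gamma> x u v)"
begin

lemma differentiable_\<Gamma>: "x \<in> S \<Longrightarrow> (\<lambda>x. \<Gamma> x u v) differentiable (at x)"
  by (rule smooth_on_differentiable[OF smooth_\<Gamma>])

lemma linear_\<Gamma>: "x \<in> S \<Longrightarrow> linear (\<Gamma> x u)" "x \<in> S \<Longrightarrow> linear (\<lambda>u. \<Gamma> x u v)"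
  using bilinear_\<Gamma> by (auto simp: bilinear_def)

lemma smooth_nabla:
  assumes "smooth_on S Y" "smooth_on S Z"
  shows "smooth_on S (nabla \<Gamma> Y Z)"
  unfolding nabla_def
proof (rule smooth_on_add[OF open_S])
  show "smooth_on S (\<lambda>x. frechet_derivative Z (at x) (Y x))"
    using smooth_on_differentiable[OF assms(2)]
    by (intro smooth_on_apply[OF open_S _ smooth_on_frechet_derivative[OF assms(2)] assms(1)]
        linear_frechet_derivative)
qed (rule smooth_on_apply2[OF open_S bilinear_\<Gamma> smooth_\<Gamma> assms])

lemma nabla_nabla:
  assumes "x \<in> S" and X: "smooth_on S X" and Y: "smooth_on S Y" and Z: "smooth_on S Z"
  shows "nabla \<Gamma> X (nabla \<Gamma> Y Z) x =
    frechet_derivative (\<lambda>y. frechet_derivative Z (at y) (Y x)) (at x) (X x)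
    + frechet_derivative Z (at x) (frechet_derivative Y (at x) (X x))
    + frechet_derivative (\<lambda>y. \<Gamma> y (Y x) (Z x)) (at x) (X x)
    + \<Gamma> x (frechet_derivative Y (at x) (X x)) (Z x) + \<Gamma> x (Y x) (frechet_derivative Z (at x) (X x))
    + \<Gamma> x (X x) (frechet_derivative Z (at x) (Y x)) + \<Gamma> x (X x) (\<Gamma> x (Y x) (Z x))"
proof -
  note d = smooth_on_differentiable[OF _ assms(1)]
  have 1: "((\<lambda>y. frechet_derivative Z (at y) (Y y)) has_derivative
      (\<lambda>u. frechet_derivative (\<lambda>y. frechet_derivative Z (at y) (Y x)) (at x) u +
        frechet_derivative Z (at x) (frechet_derivative Y (at x) u))) (at x)"
    by (rule has_derivative_apply[OF open_S assms(1) _ d[OF smooth_on_frechet_derivative[OF Z]] d[OF Y]])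
      (rule linear_frechet_derivative[OF smooth_on_differentiable[OF Z]])
  have 2: "((\<lambda>y. \<Gamma> y (Y y) (Z y)) has_derivative (\<lambda>u.
      frechet_derivative (\<lambda>y. \<Gamma> y (Y x) (Z x)) (at x) u +
      \<Gamma> x (frechet_derivative Y (at x) u) (Z x) + \<Gamma> x (Y x) (frechet_derivative Z (at x) u))) (at x)"
    by (rule has_derivative_apply2[OF open_S assms(1) bilinear_\<Gamma> differentiable_\<Gamma>[OF assms(1)]
        d[OF Y] d[OF Z]])
  show ?thesis
    by (simp add: nabla_def frechet_derivative_at[OF has_derivative_add[OF 1 2], symmetric]
        linear_add[OF linear_\<Gamma>(1)[OF assms(1)]])
qed

text \<open>Tensoriality of the curvature. After antisymmetrising in \<open>X\<close> and
  \<open>Y\<close>, the second derivatives of \<open>Z\<close> cancel by symmetry, the two terms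
  with \<Gamma> applied to a first derivative of \<open>Z\<close> swap into each other, and the
  terms with derivatives of \<open>X\<close> and \<open>Y\<close> are those of the bracket.\<close>

lemma curvature_eq_tensor:
  assumes "x \<in> S" and "smooth_on S X" and "smooth_on S Y" and "smooth_on S Z"
  shows "curvature \<Gamma> X Y Z x = curvature_tensor \<Gamma> x (X x) (Y x) (Z x)"
  using symmetric_second_derivative[OF open_S assms(1,4), of "Y x" "X x"]
  by (simp add: curvature_def nabla_nabla assms curvature_tensor_def)
    (simp add: nabla_def lie_bracket_def linear_diff[OF linear_\<Gamma>(2)[OF assms(1)]]
      linear_diff[OF linear_frechet_derivative[OF smooth_on_differentiable[OF assms(4,1)]]])

lemma linear_curvature_tensor:
  assumes "x \<in> S"
  shows "linear (\<lambda>u. curvature_tensor \<Gamma> x u v w)" "linear (\<lambda>v. curvature_tensor \<Gamma> x u v w)"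
    "linear (\<lambda>w. curvature_tensor \<Gamma> x u v w)"
  unfolding curvature_tensor_def
  using assms
  by (auto intro!: linear_compose_add linear_compose_sub linear_frechet_derivative
      linear_frechet_derivative_param[OF open_S] linear_\<Gamma> differentiable_\<Gamma>
      linear_compose[OF linear_\<Gamma>(1) linear_\<Gamma>(1), unfolded o_def]
      linear_compose[OF linear_\<Gamma>(2) linear_\<Gamma>(1), unfolded o_def])

end

subsection \<open>Traces and algebraic Kaehler curvature tensors\<close>

lemma trace_matrix: "trace (matrix f) = (\<Sum>i\<in>UNIV. f (axis i 1) $ i)"
  by (simp add: trace_def matrix_def)

lemma trace_transpose: "trace (transpose A) = trace A"
  by (simp add: trace_def transpose_def)

lemma trace_matrix_add: "trace (matrix (\<lambda>u. f u + g u)) = trace (matrix f) + trace (matrix g)"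
  and trace_matrix_diff: "trace (matrix (\<lambda>u. f u - g u)) = trace (matrix f) - trace (matrix g)"
  and trace_matrix_minus: "trace (matrix (\<lambda>u. - f u)) = - trace (matrix f)"
  for f g :: "real^'n::finite \<Rightarrow> real^'n"
  by (simp_all add: trace_matrix sum.distrib sum_subtractf sum_negf)

lemma trace_matrix_scaleR: "trace (matrix (\<lambda>u. c *\<^sub>R f u)) = c * trace (matrix f)"
  for f :: "real^'n::finite \<Rightarrow> real^'n"
  by (simp add: trace_matrix sum_distrib_left)

lemma trace_matrix_id: "trace (matrix (\<lambda>u. u :: real^'n::finite)) = real CARD('n)"
  using trace_I[where 'a = real and 'n = 'n] by (simp add: matrix_id_mat_1[unfolded id_def])

lemma trace_matrix_rank_one:
  fixes v :: "real^'n::finite"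
  assumes "linear \<phi>"
  shows "trace (matrix (\<lambda>u. \<phi> u *\<^sub>R v)) = \<phi> v"
proof -
  have "\<phi> v = \<phi> (\<Sum>i\<in>UNIV. v $ i *\<^sub>R axis i 1)"
    using basis_expansion[of v] by (simp add: scalar_mult_eq_scaleR)
  then show ?thesis
    by (simp add: trace_matrix linear_sum[OF assms] linear_cmul[OF assms] mult.commute)
qed

lemma trace_matrix_commute:
  fixes f g :: "real^'n::finite \<Rightarrow> real^'n"
  assumes "linear f" "linear g"
  shows "trace (matrix (\<lambda>u. f (g u))) = trace (matrix (\<lambda>u. g (f u)))"
  using matrix_compose[OF assms] matrix_compose[OF assms(2,1)]
    trace_mul_sym[of "matrix f" "matrix g"] by (simp add: o_def)

section \<open>Skew endomorphisms and the algebra of a Kaehler curvature tensor\<close>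

locale inner_product =
  fixes g :: "real^'n::finite \<Rightarrow> real^'n \<Rightarrow> real"
  assumes bilinear: "bilinear g"
    and symmetric: "g u v = g v u"
    and positive: "u \<noteq> 0 \<Longrightarrow> 0 < g u u"
begin

lemma linear_g: "linear (g u)" "linear (\<lambda>u. g u v)"
  using bilinear by (auto simp: bilinear_def)

lemma eqI:
  assumes "\<And>w. g u w = g v w"
  shows "u = v"
proof -
  have "g (u - v) (u - v) = 0"
    using assms by (simp add: linear_diff[OF linear_g(2)])
  then show ?thesis
    using positive[of "u - v"] by force
qed

text \<open>In place of a \<open>g\<close>-orthonormal basis, the Gram map \<gamma> translates
  \<open>g\<close> into the standard inner product. Skewness then says that \<open>L\<close> is
  conjugate under \<gamma> to the negative of its standard adjoint, which has the same trace as
  \<open>L\<close> up to sign.\<close>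

lemma trace_skew:
  assumes L: "linear L" and skew: "\<And>u v. g (L u) v = - g u (L v)"
  shows "trace (matrix L) = 0"
proof -
  define \<gamma> where "\<gamma> v = (\<chi> i. g (axis i 1) v)" for v
  have \<gamma>: "u \<bullet> \<gamma> v = g u v" for u v
  proof -
    have "g u v = g (\<Sum>i\<in>UNIV. u $ i *\<^sub>R axis i 1) v"
      using basis_expansion[of u] by (simp add: scalar_mult_eq_scaleR)
    then show ?thesis
      by (simp add: \<gamma>_def inner_vec_def linear_sum[OF linear_g(2)] linear_cmul[OF linear_g(2)])
  qed
  have "linear \<gamma>"
    by (rule linearI) (simp_all add: \<gamma>_def vec_eq_iff linear_add[OF linear_g(1)] linear_cmul[OF linear_g(1)])
  moreover have "inj \<gamma>"
    by (rule injI) (metis \<gamma> eqI symmetric)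
  \<comment> \<open>Definiteness of \<open>g\<close> makes \<gamma> injective, hence invertible in
    finite dimension.\<close>
  ultimately obtain h where h: "linear h" "\<And>v. h (\<gamma> v) = v" "\<And>v. \<gamma> (h v) = v"
    using linear_injective_isomorphism by blast
  have adj: "linear (\<lambda>v. - adjoint L v)"
    by (rule linear_compose_neg[OF adjoint_linear[OF L]])
  have "\<gamma> (L v) = - adjoint L (\<gamma> v)" for v
  proof -
    have "u \<bullet> \<gamma> (L v) = u \<bullet> (- adjoint L (\<gamma> v))" for u
      using skew[of u v] adjoint_works[OF L, of u "\<gamma> v"] by (simp add: \<gamma>)
    then show ?thesis by (metis vector_eq_ldot)
  qed
  then have "L = (\<lambda>v. h (- adjoint L (\<gamma> v)))"
    by (metis h(2))
  then have "trace (matrix L) = trace (matrix (\<lambda>v. h (- adjoint L (\<gamma> v))))"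
    by simp
  also have "\<dots> = trace (matrix (\<lambda>v. - adjoint L (\<gamma> (h v))))"
    using trace_matrix_commute[OF h(1) linear_compose[OF \<open>linear \<gamma>\<close> adj, unfolded o_def]] .
  also have "\<dots> = - trace (matrix L)"
    by (simp add: h(3) trace_matrix_minus matrix_adjoint[OF L] trace_transpose)
  finally show ?thesis by simp
qed

end

text \<open>The algebraic data left on a single tangent space: \<open>K\<close> stands for the
  curvature, \<open>J\<close> for the complex structure. The form \<open>g\<close> is an arbitrary
  inner product, since chart coordinates need not be orthonormal.\<close>

locale kaehler_curvature = inner_product +
  fixes K :: "real^'n::finite \<Rightarrow> real^'n \<Rightarrow> real^'n \<Rightarrow> real^'n" and J :: "real^'n \<Rightarrow> real^'n"
  assumes linear_K: "linear (\<lambda>u. K u v w)" "linear (\<lambda>v. K u v w)" "linear (K u v)"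
    and K_antisym: "K u v w = - K v u w"
    and bianchi: "K u v w + K v w u + K w u v = 0"
    and K_skew: "g (K u v w) z = - g w (K u v z)"
    and linear_J: "linear J"
    and J_J: "J (J u) = - u"
    and g_J: "g (J u) (J v) = g u v"
    and K_J: "K u v (J w) = J (K u v w)"
begin

definition ric where "ric v w = trace (matrix (\<lambda>u. K u v w))"

lemma trace_J: "trace (matrix J) = 0"
proof (rule trace_skew[OF linear_J])
  show "g (J u) v = - g u (J v)" for u v
    using g_J[of "J u" v] by (simp add: J_J linear_neg[OF linear_g(2)])
qed

lemma trace_K: "trace (matrix (K u v)) = 0"
  by (rule trace_skew[OF linear_K(3) K_skew])

text \<open>The classical octahedron argument: a combination of the four Bianchi identities for the
  cyclic shifts of (u, v, w, z) in which skewness within each pair cancels everything but the two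
  desired terms.\<close>

lemma K_pair_symmetric: "g (K u v w) z = g (K w z u) v"
proof -
  have skew: "g (K a b c) d = - g (K a b d) c" for a b c d
    using K_skew symmetric by metis
  have anti: "g (K a b c) d = - g (K b a c) d" for a b c d
    using K_antisym[of a b c] by (simp add: linear_neg[OF linear_g(2)])
  have cyc: "g (K a b c) d + g (K b c a) d + g (K c a b) d = 0" for a b c d
  proof -
    have "g (K a b c + K b c a + K c a b) d = 0"
      unfolding bianchi by (rule linear_0[OF linear_g(2)])
    then show ?thesis by (simp only: linear_add[OF linear_g(2)])
  qed
  show ?thesis
    using cyc[of u v w z] cyc[of v w z u] cyc[of w z u v] cyc[of z u v w]
      skew[of u v z w] skew[of v w z u] skew[of w z v u] skew[of z u w v]
      skew[of z v w u] anti[of z v u w] skew[of u w z v] anti[of u w v z]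
    by linarith
qed

text \<open>Pair symmetry moves both \<open>J\<close> from the first pair into the second, where
  they disappear because \<open>K\<close> commutes with \<open>J\<close> and \<open>J\<close> is an
  isometry.\<close>

lemma K_J_J: "K (J u) (J v) w = K u v w"
proof (rule eqI)
  fix z
  have "g (K (J u) (J v) w) z = g (K w z (J u)) (J v)"
    by (rule K_pair_symmetric)
  also have "\<dots> = g (K w z u) v"
    by (simp add: K_J g_J)
  also have "\<dots> = g (K u v w) z"
    by (rule K_pair_symmetric)
  finally show "g (K (J u) (J v) w) z = g (K u v w) z" .
qed

lemma linear_ric: "linear (ric v)"
  unfolding ric_def
  by (rule linearI) (simp_all add: linear_add[OF linear_K(3)] linear_cmul[OF linear_K(3)]
      trace_matrix_add trace_matrix_scaleR)

text \<open>By the Bianchi identity the antisymmetric part of the Ricci tensor is the trace of the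
  skew endomorphism \<open>K v w\<close>.\<close>

lemma ric_symmetric: "ric v w = ric w v"
proof -
  have "K u v w - K u w v = - K v w u" for u
    unfolding eq_neg_iff_add_eq_0 K_antisym[of u w v]
    using bianchi[of u v w] by (simp add: ac_simps)
  then have "trace (matrix (\<lambda>u. K u v w - K u w v)) = 0"
    using trace_K[of v w] by (simp add: trace_matrix_minus)
  then show ?thesis
    by (simp add: ric_def trace_matrix_diff)
qed

text \<open>One \<open>J\<close> comes out of \<open>K\<close> and is carried by cyclicity of the
  trace onto the traced argument, where together with the other it is absorbed by
  \<open>K_J_J\<close>.\<close>

lemma ric_J_J: "ric (J v) (J w) = ric v w"
proof -
  have "ric (J v) (J w) = trace (matrix (\<lambda>u. J (K u (J v) w)))"
    by (simp add: ric_def K_J)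
  also have "\<dots> = trace (matrix (\<lambda>u. K (J u) (J v) w))"
    by (rule trace_matrix_commute[OF linear_J linear_K(1)])
  also have "\<dots> = ric v w"
    by (simp add: ric_def K_J_J)
  finally show ?thesis .
qed

lemma ric_J: "ric (J v) w = - ric v (J w)"
  using ric_J_J[of v "J w"] by (simp add: J_J linear_neg[OF linear_ric])

end

subsection \<open>Kaehler curvature in a chart\<close>

lemma nabla_cong:
  assumes "open S" "x \<in> S" "Y differentiable (at x)" "\<And>y. y \<in> S \<Longrightarrow> Y y = Z y"
  shows "nabla \<Gamma> X Y x = nabla \<Gamma> X Z x"
  using frechet_derivative_transform_within_open[OF assms(3,1,2,4)] assms(2,4)
  by (simp add: nabla_def)

lemma lie_bracket_const: "lie_bracket (\<lambda>_. u) (\<lambda>_. v) = (\<lambda>_. 0)"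
  by (simp add: lie_bracket_def)

text \<open>The geometric axioms in one coordinate domain. They range over all fields smooth on
  \<open>S\<close>, so fields with constant components, and fields such as \<Gamma> applied to
  constants, are admissible test fields.\<close>

locale kaehler_chart = local_connection S \<Gamma>
  for S :: "(real^'n::finite) set" and \<Gamma> +
  fixes g :: "real^'n \<Rightarrow> real^'n \<Rightarrow> real^'n \<Rightarrow> real" and A :: "real^'n \<Rightarrow> real^'n \<Rightarrow> real^'n"
  assumes metric: "x \<in> S \<Longrightarrow> inner_product (g x)"
    and smooth_g: "smooth_on S (\<lambda>x. g x u v)"
    and linear_A: "x \<in> S \<Longrightarrow> linear (A x)"
    and smooth_A: "smooth_on S (\<lambda>x. A x u)"
    and A_A: "x \<in> S \<Longrightarrow> A x (A x u) = - u"
    and g_A: "x \<in> S \<Longrightarrow> g x (A x u) (A x v) = g x u v"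
    and torsion: "smooth_on S X \<Longrightarrow> smooth_on S Y \<Longrightarrow> x \<in> S \<Longrightarrow>
      nabla \<Gamma> X Y x - nabla \<Gamma> Y X x = lie_bracket X Y x"
    and parallel_g: "smooth_on S X \<Longrightarrow> smooth_on S Y \<Longrightarrow> smooth_on S Z \<Longrightarrow> x \<in> S \<Longrightarrow>
      frechet_derivative (\<lambda>y. g y (Y y) (Z y)) (at x) (X x) =
      g x (nabla \<Gamma> X Y x) (Z x) + g x (Y x) (nabla \<Gamma> X Z x)"
    and parallel_A: "smooth_on S X \<Longrightarrow> smooth_on S Y \<Longrightarrow> x \<in> S \<Longrightarrow> nabla_endo \<Gamma> A X Y x = 0"
begin

lemma \<Gamma>_symmetric: "x \<in> S \<Longrightarrow> \<Gamma> x u v = \<Gamma> x v u"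
  using torsion[OF smooth_on_const smooth_on_const, of x u v]
  by (simp add: lie_bracket_const) (simp add: nabla_def)

lemma bilinear_g: "x \<in> S \<Longrightarrow> bilinear (g x)"
  using metric by (auto simp: inner_product_def)

lemma linear_g: "x \<in> S \<Longrightarrow> linear (g x u)" "x \<in> S \<Longrightarrow> linear (\<lambda>u. g x u v)"
  using bilinear_g by (auto simp: bilinear_def)

lemma curvature_tensor_bianchi:
  assumes "x \<in> S"
  shows "curvature_tensor \<Gamma> x u v w + curvature_tensor \<Gamma> x v w u + curvature_tensor \<Gamma> x w u v = 0"
proof -
  have "frechet_derivative (\<lambda>y. \<Gamma> y a b) (at x) = frechet_derivative (\<lambda>y. \<Gamma> y b a) (at x)" for a b
    by (rule frechet_derivative_transform_within_open[OF differentiable_\<Gamma>[OF assms] open_S assms])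
      (rule \<Gamma>_symmetric)
  from this[of w v] this[of u w] this[of v u] show ?thesis
    unfolding curvature_tensor_def
    by (simp add: \<Gamma>_symmetric[OF assms, of w v] \<Gamma>_symmetric[OF assms, of u w]
        \<Gamma>_symmetric[OF assms, of v u])
qed

lemma nabla_const_coefficient:
  "nabla \<Gamma> (\<lambda>_. u) (\<lambda>y. \<Gamma> y v w) x = frechet_derivative (\<lambda>y. \<Gamma> y v w) (at x) u + \<Gamma> x u (\<Gamma> x v w)"
  by (simp add: nabla_def)

text \<open>Differentiate the function \<open>g y w z\<close>, with \<open>w\<close> and
  \<open>z\<close> constant, twice along constant directions. The second derivatives commute and the
  terms with one \<Gamma> in each slot of \<open>g\<close> are symmetric in the directions, so the
  antisymmetric part is the skewness of the curvature.\<close>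

lemma curvature_tensor_skew:
  assumes "x \<in> S"
  shows "g x (curvature_tensor \<Gamma> x u v w) z = - g x w (curvature_tensor \<Gamma> x u v z)"
proof -
  note [simp] = linear_add[OF linear_g(1)[OF assms]] linear_add[OF linear_g(2)[OF assms]]
    linear_diff[OF linear_g(1)[OF assms]] linear_diff[OF linear_g(2)[OF assms]]
  define f where "f y = g y w z" for y
  have f: "smooth_on S f"
    unfolding f_def by (rule smooth_g)
  have "frechet_derivative (\<lambda>y. frechet_derivative f (at y) b) (at x) a =
      g x (nabla \<Gamma> (\<lambda>_. a) (\<lambda>y. \<Gamma> y b w) x) z + g x (\<Gamma> x b w) (\<Gamma> x a z) +
      (g x (\<Gamma> x a w) (\<Gamma> x b z) + g x w (nabla \<Gamma> (\<lambda>_. a) (\<lambda>y. \<Gamma> y b z) x))" for a b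
  proof -
    have d: "smooth_on S (\<lambda>y. g y (\<Gamma> y b w) z)" "smooth_on S (\<lambda>y. g y w (\<Gamma> y b z))"
      using smooth_on_apply2[OF open_S bilinear_g smooth_g smooth_\<Gamma> smooth_on_const]
        smooth_on_apply2[OF open_S bilinear_g smooth_g smooth_on_const smooth_\<Gamma>]
      by auto
    have "frechet_derivative (\<lambda>y. frechet_derivative f (at y) b) (at x) =
        frechet_derivative (\<lambda>y. g y (\<Gamma> y b w) z + g y w (\<Gamma> y b z)) (at x)"
    proof (rule frechet_derivative_transform_within_open[OF _ open_S assms])
      show "(\<lambda>y. frechet_derivative f (at y) b) differentiable at x"
        by (rule smooth_on_differentiable[OF smooth_on_frechet_derivative[OF f] assms])
      \<comment> \<open>Metric compatibility on constant fields expresses the first derivatives of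
        \<open>g\<close> by \<Gamma>.\<close>
      show "frechet_derivative f (at y) b = g y (\<Gamma> y b w) z + g y w (\<Gamma> y b z)" if "y \<in> S" for y
        using parallel_g[OF smooth_on_const smooth_on_const smooth_on_const that, of w z b]
        unfolding f_def by (simp add: nabla_def)
    qed
    then have "frechet_derivative (\<lambda>y. frechet_derivative f (at y) b) (at x) a =
        frechet_derivative (\<lambda>y. g y (\<Gamma> y b w) z) (at x) a + frechet_derivative (\<lambda>y. g y w (\<Gamma> y b z)) (at x) a"
      using frechet_derivative_add[OF d[THEN smooth_on_differentiable, OF assms]] by simp
    also have "\<dots> = g x (nabla \<Gamma> (\<lambda>_. a) (\<lambda>y. \<Gamma> y b w) x) z + g x (\<Gamma> x b w) (\<Gamma> x a z) +
        (g x (\<Gamma> x a w) (\<Gamma> x b z) + g x w (nabla \<Gamma> (\<lambda>_. a) (\<lambda>y. \<Gamma> y b z) x))"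
      using parallel_g[OF smooth_on_const smooth_\<Gamma> smooth_on_const assms, of b w z a]
        parallel_g[OF smooth_on_const smooth_on_const smooth_\<Gamma> assms, of w b z a]
      by (simp add: nabla_def)
    finally show ?thesis .
  qed
  from this[of v u] this[of u v] symmetric_second_derivative[OF open_S assms f, of u v]
  show ?thesis
    by (simp add: nabla_const_coefficient curvature_tensor_def)
qed

text \<open>A parallel \<open>A\<close> passes through both covariant derivatives. The field
  \<open>A y w\<close> is not constant in \<open>y\<close>, so tensoriality is what identifies its
  curvature with the value at \<open>A x w\<close>.\<close>

lemma curvature_tensor_A:
  assumes "x \<in> S"
  shows "curvature_tensor \<Gamma> x u v (A x w) = A x (curvature_tensor \<Gamma> x u v w)"
proof -
  have par: "nabla \<Gamma> X (\<lambda>y. A y (Y y)) y = A y (nabla \<Gamma> X Y y)"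
    if "smooth_on S X" "smooth_on S Y" "y \<in> S" for X Y y
    using parallel_A[OF that] by (simp add: nabla_endo_def)
  have two: "nabla \<Gamma> (\<lambda>_. a) (nabla \<Gamma> (\<lambda>_. b) (\<lambda>y. A y w)) x =
      A x (nabla \<Gamma> (\<lambda>_. a) (nabla \<Gamma> (\<lambda>_. b) (\<lambda>_. w)) x)" for a b
  proof -
    have "nabla \<Gamma> (\<lambda>_. a) (nabla \<Gamma> (\<lambda>_. b) (\<lambda>y. A y w)) x =
        nabla \<Gamma> (\<lambda>_. a) (\<lambda>y. A y (nabla \<Gamma> (\<lambda>_. b) (\<lambda>_. w) y)) x"
      by (rule nabla_cong[OF open_S assms])
        (auto intro: smooth_on_differentiable[OF _ assms] smooth_nabla smooth_on_const smooth_A par)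
    also have "\<dots> = A x (nabla \<Gamma> (\<lambda>_. a) (nabla \<Gamma> (\<lambda>_. b) (\<lambda>_. w)) x)"
      by (intro par smooth_nabla smooth_on_const assms)
    finally show ?thesis .
  qed
  have "curvature_tensor \<Gamma> x u v (A x w) = curvature \<Gamma> (\<lambda>_. u) (\<lambda>_. v) (\<lambda>y. A y w) x"
    by (rule curvature_eq_tensor[OF assms smooth_on_const smooth_on_const smooth_A, symmetric])
  also have "\<dots> = A x (curvature \<Gamma> (\<lambda>_. u) (\<lambda>_. v) (\<lambda>_. w) x)"
    unfolding curvature_def two lie_bracket_const par[OF smooth_on_const smooth_on_const assms]
    by (simp add: linear_diff[OF linear_A[OF assms]])
  also have "\<dots> = A x (curvature_tensor \<Gamma> x u v w)"
    by (simp add: curvature_eq_tensor assms smooth_on_const)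
  finally show ?thesis .
qed

lemma kaehler_curvature:
  assumes "x \<in> S"
  shows "kaehler_curvature (g x) (curvature_tensor \<Gamma> x) (A x)"
proof -
  have antisym: "curvature_tensor \<Gamma> x u v w = - curvature_tensor \<Gamma> x v u w" for u v w
    by (simp add: curvature_tensor_def)
  show ?thesis
    by (intro kaehler_curvature.intro kaehler_curvature_axioms.intro metric linear_curvature_tensor
        antisym curvature_tensor_bianchi curvature_tensor_skew linear_A A_A g_A curvature_tensor_A assms)
qed

end

locale kaehler_chart_form = kaehler_chart S \<Gamma> g A
  for S :: "(real^'n::finite) set" and \<Gamma> g A +
  fixes \<pi> :: "real^'n \<Rightarrow> real^'n \<Rightarrow> real"
  assumes linear_\<pi>: "x \<in> S \<Longrightarrow> linear (\<pi> x)"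
    and smooth_\<pi>: "smooth_on S (\<lambda>x. \<pi> x u)"
begin

definition form_derivative where
  "form_derivative x u v = frechet_derivative (\<lambda>y. \<pi> y v) (at x) u - \<pi> x (\<Gamma> x u v)"

text \<open>The derivative of \<open>Y\<close> produced by the product rule cancels against the one
  inside the covariant derivative of \<open>Y\<close>.\<close>

lemma nabla_form_eq:
  assumes "x \<in> S" "smooth_on S Y"
  shows "nabla_form \<Gamma> \<pi> X Y x = form_derivative x (X x) (Y x)"
proof -
  note d = smooth_on_differentiable[OF _ assms(1)]
  note D = has_derivative_apply[OF open_S assms(1) linear_\<pi> d[OF smooth_\<pi>] d[OF assms(2)]]
  show ?thesis
    by (simp add: nabla_form_def nabla_def form_derivative_def
        frechet_derivative_at[OF D, symmetric] linear_add[OF linear_\<pi>[OF assms(1)]])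
qed

lemma linear_form_derivative:
  assumes "x \<in> S"
  shows "linear (form_derivative x u)" "linear (\<lambda>u. form_derivative x u v)"
proof -
  have "linear (\<lambda>v. frechet_derivative (\<lambda>y. \<pi> y v) (at x) u)"
    by (rule linear_frechet_derivative_param[OF open_S assms linear_\<pi>
        smooth_on_differentiable[OF smooth_\<pi> assms]])
  moreover have "linear (\<lambda>v. \<pi> x (\<Gamma> x u v))"
    using linear_compose[OF linear_\<Gamma>(1)[OF assms] linear_\<pi>[OF assms]] by (simp add: o_def)
  ultimately show "linear (form_derivative x u)"
    unfolding form_derivative_def by (rule linear_compose_sub)
  have "linear (frechet_derivative (\<lambda>y. \<pi> y v) (at x))"
    by (rule linear_frechet_derivative[OF smooth_on_differentiable[OF smooth_\<pi> assms]])
  moreover have "linear (\<lambda>u. \<pi> x (\<Gamma> x u v))"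
    using linear_compose[OF linear_\<Gamma>(2)[OF assms] linear_\<pi>[OF assms]] by (simp add: o_def)
  ultimately show "linear (\<lambda>u. form_derivative x u v)"
    unfolding form_derivative_def by (rule linear_compose_sub)
qed

end

subsection \<open>The tensor H0\<close>

context kaehler_chart_form
begin

lemma app_apply: "app_endo B X x = B x (X x)" "app_form \<rho> X x = \<rho> x (X x)"
  by (simp_all add: app_endo_def app_form_def)

lemma smooth_app_endo: "smooth_on S X \<Longrightarrow> smooth_on S (app_endo A X)"
  unfolding app_endo_def by (rule smooth_on_apply[OF open_S linear_A smooth_A])

lemma linear_simps:
  assumes "x \<in> S"
  shows "A x (u + v) = A x u + A x v" "A x (r *\<^sub>R u) = r *\<^sub>R A x u" "A x (- u) = - A x u"
    "\<pi> x (u + v) = \<pi> x u + \<pi> x v" "\<pi> x (r *\<^sub>R u) = r * \<pi> x u" "\<pi> x (- u) = - \<pi> x u"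
    "form_derivative x (u + v) w = form_derivative x u w + form_derivative x v w"
    "form_derivative x w (u + v) = form_derivative x w u + form_derivative x w v"
    "form_derivative x (r *\<^sub>R u) w = r * form_derivative x u w"
    "form_derivative x w (r *\<^sub>R u) = r * form_derivative x w u"
    "form_derivative x (- u) w = - form_derivative x u w"
    "form_derivative x w (- u) = - form_derivative x w u"
  using assms
  by (simp_all add: linear_add linear_cmul linear_neg linear_A linear_\<pi> linear_form_derivative(1)
      linear_add[OF linear_form_derivative(2)] linear_cmul[OF linear_form_derivative(2)]
      linear_neg[OF linear_form_derivative(2)])

context
  fixes x and Y Z :: "real^'n \<Rightarrow> real^'n"
  assumes x: "x \<in> S" and Y: "smooth_on S Y" and Z: "smooth_on S Z"
begin

interpretation kaehler_curvature "g x" "curvature_tensor \<Gamma> x" "A x"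
  by (rule kaehler_curvature[OF x])

lemmas pointwise_simps = nabla_form_eq[OF x] curvature_eq_tensor[OF x] smooth_on_const Y Z
  smooth_app_endo app_apply

lemma ricci_curvature: "ricci (curvature \<Gamma>) Y Z x = ric (Y x) (Z x)"
  by (simp add: ricci_def ric_def pointwise_simps)

text \<open>A term \<phi>(u)v has trace \<phi>(v), so the trace puts AZ into the free slot of
  \<open>D1\<close>.\<close>

lemma ricci_R1:
  "ricci (R1 A \<Gamma> \<pi>) Y Z x = ric (Y x) (Z x) -
     (form_derivative x (A x (Z x)) (Y x) - form_derivative x (Y x) (A x (Z x)))"
proof -
  let ?\<phi> = "\<lambda>u. form_derivative x u (Y x) - form_derivative x (Y x) u"
  have "linear ?\<phi>"
    by (rule linearI) (simp_all add: linear_simps[OF x] algebra_simps)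
  then show ?thesis
    by (simp add: ricci_def R1_def D1_def ric_def pointwise_simps
        trace_matrix_diff trace_matrix_rank_one)
qed

lemma ricci_R3:
  "ricci (R3 A \<Gamma> \<pi>) Y Z x = ric (Y x) (Z x) - form_derivative x (A x (Z x)) (Y x)
     + \<pi> x (Y x) * \<pi> x (Z x)"
proof -
  let ?\<phi> = "\<lambda>u. form_derivative x u (Y x) + \<pi> x (Y x) * \<pi> x (A x u)"
  have "linear ?\<phi>"
    by (rule linearI) (simp_all add: linear_simps[OF x] algebra_simps)
  then show ?thesis
    by (simp add: ricci_def R3_def D2_def D3_def ric_def pointwise_simps
        trace_matrix_add trace_matrix_diff trace_matrix_rank_one trace_matrix_scaleR trace_J
        J_J linear_simps[OF x])
qed

text \<open>The traces of the curvature endomorphism and of A vanish, so only the rank-one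
  \<open>D3\<close> term survives; the minus sign comes from the square of A.\<close>

lemma ricci'_R3:
  "ricci' (R3 A \<Gamma> \<pi>) Y Z x = form_derivative x (Z x) (A x (Y x)) - \<pi> x (Z x) * \<pi> x (Y x)"
proof -
  let ?\<phi> = "\<lambda>u. form_derivative x (Z x) u + \<pi> x (Z x) * \<pi> x (A x u)"
  have "linear ?\<phi>"
    by (rule linearI) (simp_all add: linear_simps[OF x] algebra_simps)
  then show ?thesis
    by (simp add: ricci'_def R3_def D2_def D3_def pointwise_simps
        trace_matrix_add trace_matrix_diff trace_matrix_rank_one trace_matrix_scaleR trace_J trace_K
        J_J linear_simps[OF x])
qed

text \<open>The factor n/4 is made of (n - 1)/4 from the last term of \<open>R0\<close> and 1/4 from
  \<open>D0\<close> evaluated at AY, where A squared is minus the identity. The quadratic part of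
  \<open>D0\<close> is symmetric and drops out of the difference.\<close>

lemma ricci_R0:
  "ricci (R0 A \<Gamma> \<pi>) Y Z x = ric (Y x) (Z x)
     - (form_derivative x (A x (Z x)) (Y x) - form_derivative x (Y x) (A x (Z x))) / 2
     - form_derivative x (A x (Y x)) (Z x) / 2 - \<pi> x (A x (Y x)) * \<pi> x (A x (Z x)) / 4
     + real CARD('n) / 4 * \<pi> x (Y x) * \<pi> x (Z x)"
proof -
  let ?d = "\<lambda>u v. form_derivative x u v + 1/2 * \<pi> x u * \<pi> x (A x v) + 1/2 * \<pi> x v * \<pi> x (A x u)"
  have 1: "linear (\<lambda>u. 1/2 * (?d u (Y x) - ?d (Y x) u))"
    by (rule linearI) (simp_all add: linear_simps[OF x] algebra_simps)
  have 2: "linear (\<lambda>u. 1/2 * ?d u (Z x))"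
    by (rule linearI) (simp_all add: linear_simps[OF x] algebra_simps)
  have "ricci (R0 A \<Gamma> \<pi>) Y Z x = trace (matrix (\<lambda>u. curvature_tensor \<Gamma> x u (Y x) (Z x)
      - (1/2 * (?d u (Y x) - ?d (Y x) u)) *\<^sub>R A x (Z x) - (1/2 * ?d u (Z x)) *\<^sub>R A x (Y x)
      + (1/2 * ?d (Y x) (Z x)) *\<^sub>R A x u
      + (1/4 * \<pi> x (Z x)) *\<^sub>R (\<pi> x (Y x) *\<^sub>R u - \<pi> x u *\<^sub>R Y x)))"
    by (simp add: ricci_def R0_def D0_def pointwise_simps)
  also have "\<dots> = ric (Y x) (Z x) - 1/2 * (?d (A x (Z x)) (Y x) - ?d (Y x) (A x (Z x)))
      - 1/2 * ?d (A x (Y x)) (Z x)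
      + 1/4 * \<pi> x (Z x) * (\<pi> x (Y x) * real CARD('n) - \<pi> x (Y x))"
    unfolding trace_matrix_add trace_matrix_diff trace_matrix_rank_one[OF 1]
      trace_matrix_rank_one[OF 2] trace_matrix_rank_one[OF linear_\<pi>[OF x]] trace_matrix_scaleR
      trace_J trace_matrix_id ric_def by simp
  finally show ?thesis
    by (simp add: J_J linear_simps[OF x] field_simps)
qed

end

text \<open>Sorting \<open>H0\<close> by the vectors that occur in it leaves three kinds of scalar
  coefficient, each of which is computed on its own from the traces.\<close>

lemma H0_eq:
  assumes x: "x \<in> S" and X: "smooth_on S X" and Y: "smooth_on S Y" and Z: "smooth_on S Z"
    and n: "CARD('n) \<noteq> 1"
  shows "H0 A \<Gamma> \<pi> X Y Z x = curvature \<Gamma> X Y Z x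
    + (1 / (4 * (real CARD('n) - 1))) *\<^sub>R
        (ricci (curvature \<Gamma>) X Z x *\<^sub>R Y x - ricci (curvature \<Gamma>) Y Z x *\<^sub>R X x)
    - (1/4) *\<^sub>R (ricci (curvature \<Gamma>) X (app_endo A Z) x *\<^sub>R app_endo A Y x
        - ricci (curvature \<Gamma>) Y (app_endo A Z) x *\<^sub>R app_endo A X x
        + (2 * ricci (curvature \<Gamma>) X (app_endo A Y) x) *\<^sub>R app_endo A Z x)"
proof -
  interpret kaehler_curvature "g x" "curvature_tensor \<Gamma> x" "A x"
    by (rule kaehler_curvature[OF x])
  define m where "m = real CARD('n) - 1"
  have card: "real CARD('n) = m + 1" and m: "m \<noteq> 0"
    using n by (simp_all add: m_def)
  let ?Ric = "ricci (curvature \<Gamma>)" and ?J = "app_endo A"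
  \<comment> \<open>\<open>\<alpha> X\<close> is the coefficient of Y and
    \<open>- \<alpha> Y\<close> that of X. The last summand is the quadratic term of
    \<open>R0\<close>; it cancels the part of the trace of \<open>R0\<close> that is proportional to
    n - 1.\<close>
  define \<alpha> where "\<alpha> V =
    1 / m * ricci (R0 A \<Gamma> \<pi>) V Z x - 1 / (2 * m) * ricci (R1 A \<Gamma> \<pi>) V Z x
    - 1 / (4 * m) * (ricci (R3 A \<Gamma> \<pi>) Z V x + ricci' (R3 A \<Gamma> \<pi>) (?J Z) (?J V) x)
    - 1/4 * app_form \<pi> Z x * app_form \<pi> V x" for V
  \<comment> \<open>\<open>\<beta> X\<close> and \<open>- \<beta> Y\<close> are the coefficients of
    AY and AX; \<gamma> below is that of AZ.\<close>
  define \<beta> where "\<beta> V = 1/4 * ricci (R3 A \<Gamma> \<pi>) Z (?J V) x - 1/4 * ricci' (R3 A \<Gamma> \<pi>) (?J Z) V x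
    - 1/2 * D0 A \<Gamma> \<pi> V Z x" for V
  define \<gamma> where "\<gamma> = 1/2 * ricci (R1 A \<Gamma> \<pi>) Y (?J X) x
    - 1/2 * (D0 A \<Gamma> \<pi> X Y x - D0 A \<Gamma> \<pi> Y X x)"
  note smooth = X Y Z smooth_app_endo
  note vals = ricci_R0[OF x] ricci_R1[OF x] ricci_R3[OF x] ricci'_R3[OF x] ricci_curvature[OF x]
    smooth D0_def app_apply nabla_form_eq[OF x] J_J linear_simps[OF x] card
  have \<alpha>: "\<alpha> V = 1 / (4 * m) * ?Ric V Z x" if "smooth_on S V" for V
    using m that ric_symmetric[of "Z x" "V x"]
    unfolding \<alpha>_def by (simp add: vals) (simp add: field_simps)
  have \<beta>: "\<beta> V = - 1/4 * ?Ric V (?J Z) x" if "smooth_on S V" for V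
    using that ric_symmetric[of "Z x" "A x (V x)"] ric_J[of "V x" "Z x"]
    unfolding \<beta>_def by (simp add: vals) (simp add: field_simps)
  have \<gamma>: "\<gamma> = - 1/2 * ?Ric X (?J Y) x"
    using ric_symmetric[of "Y x" "A x (X x)"] ric_J[of "X x" "Y x"]
    unfolding \<gamma>_def by (simp add: vals) (simp add: field_simps)
  have "H0 A \<Gamma> \<pi> X Y Z x = curvature \<Gamma> X Y Z x + \<alpha> X *\<^sub>R Y x - \<alpha> Y *\<^sub>R X x
      + \<beta> X *\<^sub>R ?J Y x - \<beta> Y *\<^sub>R ?J X x + \<gamma> *\<^sub>R ?J Z x"
    unfolding H0_def R0_def[of A \<Gamma> \<pi> X Y Z] m_def[symmetric] \<alpha>_def \<beta>_def \<gamma>_def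
    by (simp only: scaleR_add_left scaleR_diff_left scaleR_add_right scaleR_diff_right
        distrib_left right_diff_distrib scaleR_scaleR) (simp add: algebra_simps)
  then show ?thesis
    unfolding m_def[symmetric]
    by (simp add: \<alpha> \<beta> \<gamma> X Y algebra_simps)
qed

end

section \<open>Elimination of the complex part and conclusion\<close>

text \<open>\<open>T\<close> is the Ricci bracket shared by both projective tensors,
  \<open>B\<close> the one containing A. The hypothesis gives B = 4K + T/(n - 1), and both resulting
  coefficients carry the factor (n - 2)/(n + 2), since 1 - 4/(n + 2) equals it and 1 - 1/(n - 1) =
  (n - 2)/(n - 1).\<close>

lemma projective_identity:
  fixes K T B :: "'a::real_vector" and n :: real
  assumes "n > 1" and "K + (1 / (4 * (n - 1))) *\<^sub>R T - (1/4) *\<^sub>R B = 0"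
  shows "K + (1 / (n + 2)) *\<^sub>R T - (1 / (n + 2)) *\<^sub>R B = ((n - 2) / (n + 2)) *\<^sub>R (K + (1 / (n - 1)) *\<^sub>R T)"
proof -
  have "B = 4 *\<^sub>R ((1/4) *\<^sub>R B)" by simp
  also have "(1/4) *\<^sub>R B = K + (1 / (4 * (n - 1))) *\<^sub>R T"
    using assms(2) by simp
  also have "4 *\<^sub>R \<dots> = 4 *\<^sub>R K + (4 * (1 / (4 * (n - 1)))) *\<^sub>R T"
    by (simp only: scaleR_add_right scaleR_scaleR)
  also have "4 * (1 / (4 * d)) = 1 / d" for d :: real
    by simp
  finally have B: "B = 4 *\<^sub>R K + (1 / (n - 1)) *\<^sub>R T" .
  have "K + (1 / (n + 2)) *\<^sub>R T - (1 / (n + 2)) *\<^sub>R B =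
      (1 - 4 / (n + 2)) *\<^sub>R K + (1 / (n + 2) - 1 / (n + 2) * (1 / (n - 1))) *\<^sub>R T"
    by (simp add: B algebra_simps)
  also have "1 - 4 / (n + 2) = (n - 2) / (n + 2)"
    using assms(1) by (simp add: field_simps)
  also have "1 / (n + 2) - 1 / (n + 2) * (1 / (n - 1)) = (n - 2) / (n + 2) * (1 / (n - 1))"
    using assms(1) by (simp add: divide_simps)
  finally show ?thesis
    by (simp add: scaleR_add_right)
qed

theorem theorem5p2:
  fixes M :: "'m topology"
    and \<A> :: "('m, 'n::finite) chart set"
    and g :: "('m, 'n) chart \<Rightarrow> real^'n \<Rightarrow> real^'n \<Rightarrow> real^'n \<Rightarrow> real"
    and A :: "('m, 'n) chart \<Rightarrow> real^'n \<Rightarrow> real^'n \<Rightarrow> real^'n"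
    and \<Gamma> \<Gamma>1 :: "('m, 'n) chart \<Rightarrow> real^'n \<Rightarrow> real^'n \<Rightarrow> real^'n \<Rightarrow> real^'n"
    and \<pi> :: "('m, 'n) chart \<Rightarrow> real^'n \<Rightarrow> real^'n \<Rightarrow> real"
    and n :: nat
  assumes dim: "n = CARD('n)"
    and kaehler: "kaehler_manifold M \<A> g A \<Gamma>"
    and connection: "quarter_symmetric_metric_A_connection \<A> A \<Gamma> \<pi> \<Gamma>1"
    and H_vanishes: "\<forall>X Y Z. vector_field \<A> X \<longrightarrow> vector_field \<A> Y \<longrightarrow> vector_field \<A> Z \<longrightarrow>
      (\<forall>c\<in>\<A>. \<forall>x\<in>chart_image c. H0 (A c) (\<Gamma> c) (\<pi> c) (X c) (Y c) (Z c) x = 0)"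
  shows "\<forall>X Y Z. vector_field \<A> X \<longrightarrow> vector_field \<A> Y \<longrightarrow> vector_field \<A> Z \<longrightarrow>
      (\<forall>c\<in>\<A>. \<forall>x\<in>chart_image c.
         holomorphically_projective (A c) (\<Gamma> c) (X c) (Y c) (Z c) x =
         ((real n - 2) / (real n + 2)) *\<^sub>R weyl_projective (\<Gamma> c) (X c) (Y c) (Z c) x)"
proof (intro allI impI ballI)
  fix X Y Z c x
  assume XYZ: "vector_field \<A> X" "vector_field \<A> Y" "vector_field \<A> Z"
    and c: "c \<in> \<A>" and x: "x \<in> chart_image c"
  \<comment> \<open>The claim is pointwise, so it suffices to work with the local representatives in
    the one chart \<open>c\<close>.\<close>
  interpret kaehler_chart_form "chart_image c" "\<Gamma> c" "g c" "A c" "\<pi> c"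
  proof (intro kaehler_chart_form.intro kaehler_chart.intro local_connection.intro
      kaehler_chart_axioms.intro kaehler_chart_form_axioms.intro)
    show "open (chart_image c)"
      using kaehler c by (auto simp: kaehler_manifold_def smooth_manifold_def)
    show "bilinear (\<Gamma> c x)" if "x \<in> chart_image c" for x
      using kaehler c that by (auto simp: kaehler_manifold_def levi_civita_def affine_connection_def)
    show "smooth_on (chart_image c) (\<lambda>x. \<Gamma> c x u v)" for u v
      using kaehler c by (auto simp: kaehler_manifold_def levi_civita_def affine_connection_def)
    show "inner_product (g c x)" if "x \<in> chart_image c" for x
      using kaehler c that
      by (auto simp: kaehler_manifold_def riemannian_metric_def intro!: inner_product.intro)
    show "smooth_on (chart_image c) (\<lambda>x. g c x u v)" for u v
      using kaehler c by (auto simp: kaehler_manifold_def riemannian_metric_def)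
    show "linear (A c x)" if "x \<in> chart_image c" for x
      using kaehler c that by (auto simp: kaehler_manifold_def tensor_field_1_1_def)
    show "smooth_on (chart_image c) (\<lambda>x. A c x u)" for u
      using kaehler c by (auto simp: kaehler_manifold_def tensor_field_1_1_def)
    show "A c x (A c x u) = - u" "g c x (A c x u) (A c x v) = g c x u v"
      if "x \<in> chart_image c" for x u v
      using kaehler c that by (auto simp: kaehler_manifold_def)
    show "nabla (\<Gamma> c) X Y x - nabla (\<Gamma> c) Y X x = lie_bracket X Y x"
      if "smooth_on (chart_image c) X" "smooth_on (chart_image c) Y" "x \<in> chart_image c" for X Y x
      using kaehler c that by (simp add: kaehler_manifold_def levi_civita_def torsion_free_def)
    show "frechet_derivative (\<lambda>y. g c y (Y y) (Z y)) (at x) (X x) =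
        g c x (nabla (\<Gamma> c) X Y x) (Z x) + g c x (Y x) (nabla (\<Gamma> c) X Z x)"
      if "smooth_on (chart_image c) X" "smooth_on (chart_image c) Y" "smooth_on (chart_image c) Z"
        "x \<in> chart_image c" for X Y Z x
      using kaehler c that by (simp add: kaehler_manifold_def levi_civita_def metric_connection_def)
    show "nabla_endo (\<Gamma> c) (A c) X Y x = 0"
      if "smooth_on (chart_image c) X" "smooth_on (chart_image c) Y" "x \<in> chart_image c" for X Y x
      using kaehler c that by (simp add: kaehler_manifold_def)
    show "linear (\<pi> c x)" if "x \<in> chart_image c" for x
      using connection c that
      by (simp add: quarter_symmetric_metric_A_connection_def one_form_def)
    show "smooth_on (chart_image c) (\<lambda>x. \<pi> c x u)" for u
      using connection c by (simp add: quarter_symmetric_metric_A_connection_def one_form_def)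
  qed
  have smooth: "smooth_on (chart_image c) (X c)" "smooth_on (chart_image c) (Y c)"
    "smooth_on (chart_image c) (Z c)"
    using XYZ c by (auto simp: vector_field_def)
  have n: "real n > 1" "CARD('n) \<noteq> 1"
    using kaehler by (auto simp: kaehler_manifold_def dim)
  have "H0 (A c) (\<Gamma> c) (\<pi> c) (X c) (Y c) (Z c) x = 0"
    using H_vanishes XYZ c x by blast
  then show "holomorphically_projective (A c) (\<Gamma> c) (X c) (Y c) (Z c) x =
      ((real n - 2) / (real n + 2)) *\<^sub>R weyl_projective (\<Gamma> c) (X c) (Y c) (Z c) x"
    unfolding holomorphically_projective_def weyl_projective_def H0_eq[OF x smooth n(2)] dim[symmetric]
    by (rule projective_identity[OF n(1)])
qed

end
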